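(* For every statement $S$ (relative to a fixed procedure declaration $\mathbf{proc}_1\Leftarrow S_1,\ldots,\mathbf{proc}_n\Leftarrow S_n$) and every partial density operator $\rho$ whose variables include those of $S$, $$\llbracket S\rrbracket(\rho)=\sum_{\langle S,\rho\rangle\xrightarrow{\alpha}\langle E,\rho'\rangle}\rho',$$ where the sum ranges over all label sequences $\alpha$ such that $\langle S,\rho\rangle\xrightarrow{\alpha}\langle E,\rho'\rangle$ for some $\rho'$ (each such $\alpha$ contributing its $\rho'$, with repetitions of equal $\rho'$ counted separately).
   Context: Quantum variables have type Boolean (space $\mathbb{C}^2$) or integer (infinite-dimensional space with orthonormal basis $\{|n\rangle:n\in\mathbb{Z}\}$); $\mathcal{H}_{\bar q}=\bigotimes_i\mathcal{H}_{q_i}$. A quantum operation (QOP) is a linear, completely positive, trace-nonincreasing superoperator on partial density operators (positive operators of trace $\le1$); $A\diamond B$ denotes $\rho\mapsto A\rho B$; operations on subsystems are tensored with identity on the rest; QOPs are ordered by $\mathcal{E}\sqsubseteq\mathcal{F}$ iff $\mathcal{F}(\rho)-\mathcal{E}(\rho)\ge0$ for all $\rho$, and increasing sequences have pointwise least upper bounds $\bigsqcup$. Statements: $S::=\mathbf{bottom}\mid\mathbf{skip}\mid q:=|0\rangle\mid\bar q:=U\bar q\ (U\text{ unitary})\mid S_1;S_2\mid\mathbf{if}\ (\Box m\cdot M[\bar q]=m\to S_m)\ \mathbf{fi}\ (\{M_m\}\text{ a measurement},\ \sum_mM_m^\dagger M_m=I)\mid\mathbf{call}\ \mathbf{proc}_i$.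 Denotational semantics $\llbracket\cdot\rrbracket$ (a QOP): $\llbracket\mathbf{bottom}\rrbracket=0\diamond0$; $\llbracket\mathbf{skip}\rrbracket=I\diamond I$; $\llbracket q:=|0\rangle\rrbracket=\sum_i|0\rangle_q\langle i|\diamond|i\rangle_q\langle0|$; $\llbracket\bar q:=U\bar q\rrbracket=U\diamond U^\dagger$; $\llbracket S_1;S_2\rrbracket=\llbracket S_2\rrbracket\circ\llbracket S_1\rrbracket$; $\llbracket\mathbf{if}\cdots\mathbf{fi}\rrbracket=\sum_m\llbracket S_m\rrbracket\circ(M_m\diamond M_m^\dagger)$; $\llbracket\mathbf{call}\ \mathbf{proc}_i\rrbracket=\bigsqcup_{k\ge0}\llbracket S_i^{(k)}\rrbracket$, where $S_i^{(0)}=\mathbf{bottom}$ and $S_i^{(k+1)}$ is $S_i$ with each $\mathbf{call}\ \mathbf{proc}_j$ simultaneously replaced by $\mathbf{skip};S_j^{(k)}$. Operational semantics: configurations $\langle S,\rho\rangle$, where $S$ may be the empty statement $E$; one-step labeled transitions with labels $l\in\{\epsilon\}\cup\{\text{measurement outcomes}\}$: $\langle\mathbf{bottom},\rho\rangle\xrightarrow{\epsilon}\langle E,0\rangle$; $\langle\mathbf{skip},\rho\rangle\xrightarrow{\epsilon}\langle E,\rho\rangle$; $\langle q:=|0\rangle,\rho\rangle\xrightarrow{\epsilon}\langle E,\sum_i|0\rangle_q\langle i|\rho|i\rangle_q\langle0|\rangle$; $\langle\bar q:=U\bar q,\rho\rangle\xrightarrow{\epsilon}\langle E,U\rho U^\dagger\rangle$;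 if $\langle S_1,\rho\rangle\xrightarrow{l}\langle S_1',\rho'\rangle$ with $S_1'\ne E$ then $\langle S_1;S_2,\rho\rangle\xrightarrow{l}\langle S_1';S_2,\rho'\rangle$; if $\langle S_1,\rho\rangle\xrightarrow{l}\langle E,\rho'\rangle$ then $\langle S_1;S_2,\rho\rangle\xrightarrow{l}\langle S_2,\rho'\rangle$; $\langle\mathbf{if}\ (\Box m\cdot M[\bar q]=m\to S_m)\ \mathbf{fi},\rho\rangle\xrightarrow{m}\langle S_m,M_m\rho M_m^\dagger\rangle$; $\langle\mathbf{call}\ \mathbf{proc}_i,\rho\rangle\xrightarrow{\epsilon}\langle S_i,\rho\rangle$; all other combinations of statement and label lead to a failure state $\bot$. Multi-step transitions $\xrightarrow{\alpha}$ for nonempty label sequences $\alpha$: $\xrightarrow{l}$ for $\alpha=l$, and $\langle S,\rho\rangle\xrightarrow{\alpha_1\alpha_2}C$ iff $\langle S,\rho\rangle\xrightarrow{\alpha_1}\langle S'',\rho''\rangle\xrightarrow{\alpha_2}C$ for some $S'',\rho''$. *)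

theory Defs
  imports "HOL-Analysis.Analysis"
begin

section \<open>Square-summable functions\<close>

typedef 'a ell2 = "{f :: 'a \<Rightarrow> complex. (\<lambda>x. (cmod (f x))\<^sup>2) summable_on UNIV}"
  morphisms coeff Abs_ell2
  by (rule exI[of _ "\<lambda>_. 0"]) simp

setup_lifting type_definition_ell2

lemma ell2_inner_summable:
  fixes f g :: "'a \<Rightarrow> complex"
  assumes "(\<lambda>x. (cmod (f x))\<^sup>2) summable_on A" "(\<lambda>x. (cmod (g x))\<^sup>2) summable_on A"
  shows "(\<lambda>x. cmod (f x) * cmod (g x)) summable_on A"
proof (rule summable_on_comparison_test)
  show "(\<lambda>x. (cmod (f x))\<^sup>2 + (cmod (g x))\<^sup>2) summable_on A"
    using assms by (rule summable_on_add)
next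
  fix x
  have "0 \<le> (cmod (f x) - cmod (g x))\<^sup>2"
    by simp
  then have "2 * (cmod (f x) * cmod (g x)) \<le> (cmod (f x))\<^sup>2 + (cmod (g x))\<^sup>2"
    unfolding power2_diff by simp
  moreover have "0 \<le> cmod (f x) * cmod (g x)"
    by simp
  ultimately show "cmod (f x) * cmod (g x) \<le> (cmod (f x))\<^sup>2 + (cmod (g x))\<^sup>2"
    by linarith
qed simp

lemma ell2_add_closed:
  fixes f g :: "'a \<Rightarrow> complex"
  assumes "(\<lambda>x. (cmod (f x))\<^sup>2) summable_on A" "(\<lambda>x. (cmod (g x))\<^sup>2) summable_on A"
  shows "(\<lambda>x. (cmod (f x + g x))\<^sup>2) summable_on A"
proof (rule summable_on_comparison_test)
  show "(\<lambda>x. ((cmod (f x))\<^sup>2 + (cmod (g x))\<^sup>2) + 2 * (cmod (f x) * cmod (g x))) summable_on A"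
    using assms by (intro summable_on_add summable_on_cmult_right ell2_inner_summable)
next
  fix x
  have "(cmod (f x + g x))\<^sup>2 \<le> (cmod (f x) + cmod (g x))\<^sup>2"
    by (intro power_mono norm_triangle_ineq) simp
  then show "(cmod (f x + g x))\<^sup>2
      \<le> ((cmod (f x))\<^sup>2 + (cmod (g x))\<^sup>2) + 2 * (cmod (f x) * cmod (g x))"
    unfolding power2_sum by simp
qed simp

lemma ell2_scale_closed:
  fixes f :: "'a \<Rightarrow> complex"
  assumes "(\<lambda>x. (cmod (f x))\<^sup>2) summable_on A"
  shows "(\<lambda>x. (cmod (c * f x))\<^sup>2) summable_on A"
  using summable_on_cmult_right[OF assms, of "(cmod c)\<^sup>2"]
  by (simp add: norm_mult power_mult_distrib)

lift_definition scaleC :: "complex \<Rightarrow> 'a ell2 \<Rightarrow> 'a ell2"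
  is "\<lambda>c f x. c * f x"
  by (rule ell2_scale_closed)

lift_definition ket :: "'a \<Rightarrow> 'a ell2" is "\<lambda>a x. if x = a then 1 else 0"
  by (rule finite_nonzero_values_imp_summable_on, rule finite_subset[where B = "{a}" for a]) auto

lift_definition cinner :: "'a ell2 \<Rightarrow> 'a ell2 \<Rightarrow> complex"
  is "\<lambda>f g. \<Sum>\<^sub>\<infinity>x. cnj (f x) * g x" .

instantiation ell2 :: (type) real_inner
begin

lift_definition zero_ell2 :: "'a ell2" is "\<lambda>_. 0" by simp

lift_definition plus_ell2 :: "'a ell2 \<Rightarrow> 'a ell2 \<Rightarrow> 'a ell2" is "\<lambda>f g x. f x + g x"
  by (rule ell2_add_closed)

lift_definition uminus_ell2 :: "'a ell2 \<Rightarrow> 'a ell2" is "\<lambda>f x. - f x" by simp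

lift_definition minus_ell2 :: "'a ell2 \<Rightarrow> 'a ell2 \<Rightarrow> 'a ell2" is "\<lambda>f g x. f x - g x"
  subgoal for f g using ell2_add_closed[of f UNIV "\<lambda>x. - g x"] by simp
  done

lift_definition scaleR_ell2 :: "real \<Rightarrow> 'a ell2 \<Rightarrow> 'a ell2" is "\<lambda>c f x. c *\<^sub>R f x"
  unfolding scaleR_conv_of_real by (rule ell2_scale_closed)

(* This is Re (cinner f g). *)
lift_definition inner_ell2 :: "'a ell2 \<Rightarrow> 'a ell2 \<Rightarrow> real"
  is "\<lambda>f g. \<Sum>\<^sub>\<infinity>x. inner (f x) (g x)" .

definition norm_ell2 :: "'a ell2 \<Rightarrow> real" where "norm_ell2 f = sqrt (inner f f)"
definition dist_ell2 :: "'a ell2 \<Rightarrow> 'a ell2 \<Rightarrow> real" where "dist_ell2 f g = norm (f - g)"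
definition sgn_ell2 :: "'a ell2 \<Rightarrow> 'a ell2" where "sgn_ell2 f = inverse (norm f) *\<^sub>R f"
definition uniformity_ell2 :: "('a ell2 \<times> 'a ell2) filter" where
  "uniformity_ell2 = (INF e\<in>{0<..}. principal {(x, y). dist x y < e})"
definition open_ell2 :: "'a ell2 set \<Rightarrow> bool" where
  "open_ell2 U = (\<forall>x\<in>U. \<forall>\<^sub>F (x', y) in uniformity. x' = x \<longrightarrow> y \<in> U)"

lemma inner_coeff_summable:
  "(\<lambda>x. inner (coeff f x) (coeff g x)) summable_on UNIV"
proof -
  have "(\<lambda>x. cmod (coeff f x) * cmod (coeff g x)) summable_on UNIV"
    using coeff[of f] coeff[of g] by (intro ell2_inner_summable) auto
  then have "(\<lambda>x. norm (inner (coeff f x) (coeff g x))) summable_on UNIV"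
    by (rule summable_on_comparison_test) (auto simp: Cauchy_Schwarz_ineq2)
  then show ?thesis
    by (rule abs_summable_summable)
qed

instance
proof
  fix a b c :: "'a ell2" and r s :: real
  show "a + b + c = a + (b + c)" by transfer (simp add: add.assoc)
  show "a + b = b + a" by transfer (simp add: add.commute)
  show "0 + a = a" by transfer simp
  show "- a + a = 0" by transfer simp
  show "a - b = a + - b" by transfer simp
  show "r *\<^sub>R (a + b) = r *\<^sub>R a + r *\<^sub>R b" by transfer (simp add: scaleR_right_distrib)
  show "(r + s) *\<^sub>R a = r *\<^sub>R a + s *\<^sub>R a" by transfer (simp add: scaleR_left_distrib)
  show "r *\<^sub>R s *\<^sub>R a = (r * s) *\<^sub>R a" by transfer simp
  show "1 *\<^sub>R a = a" by transfer simp
  show "dist a b = norm (a - b)" by (rule dist_ell2_def)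
  show "sgn a = inverse (norm a) *\<^sub>R a" by (rule sgn_ell2_def)
  show "uniformity = (INF e\<in>{0<..}. principal {(x, y :: 'a ell2). dist x y < e})"
    by (rule uniformity_ell2_def)
  show "open U = (\<forall>x\<in>U. \<forall>\<^sub>F (x', y) in uniformity. x' = x \<longrightarrow> y \<in> U)" for U :: "'a ell2 set"
    by (rule open_ell2_def)
  show "inner a b = inner b a" by transfer (simp add: inner_commute)
  show "inner (a + b) c = inner a c + inner b c"
    using inner_coeff_summable[of a c] inner_coeff_summable[of b c]
    by transfer (simp add: inner_add_left infsum_add)
  show "inner (r *\<^sub>R a) b = r * inner a b"
    by transfer (simp add: infsum_cmult_right')
  show "0 \<le> inner a a" by transfer (simp add: infsum_nonneg)
  show "inner a a = 0 \<longleftrightarrow> a = 0"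
  proof
    assume "inner a a = 0"
    then have "(\<Sum>\<^sub>\<infinity>x. inner (coeff a x) (coeff a x)) = 0"
      by (simp add: inner_ell2.rep_eq)
    then have "inner (coeff a x) (coeff a x) = 0" for x
      using nonneg_infsum_le_0D[of "\<lambda>x. inner (coeff a x) (coeff a x)" UNIV x]
        inner_coeff_summable[of a a] by simp
    then have "coeff a x = 0" for x by simp
    then show "a = 0" by transfer (simp add: fun_eq_iff)
  qed (transfer, simp)
  show "norm a = sqrt (inner a a)" by (rule norm_ell2_def)
qed

end

section \<open>Bounded operators\<close>

(* blinfun only provides real linearity; complex linearity is imposed by clinear_op. *)
type_synonym 'a op = "'a ell2 \<Rightarrow>\<^sub>L 'a ell2"

definition clinear_op :: "'a op \<Rightarrow> bool" where
  "clinear_op A \<longleftrightarrow> (\<forall>c \<psi>. A (scaleC c \<psi>) = scaleC c (A \<psi>))"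

definition adj :: "'a op \<Rightarrow> 'a op" where
  "adj A = (THE B. clinear_op B \<and> (\<forall>\<phi> \<psi>. cinner (B \<phi>) \<psi> = cinner \<phi> (A \<psi>)))"

definition matrix_op :: "('a \<Rightarrow> 'a \<Rightarrow> complex) \<Rightarrow> 'a op" where
  "matrix_op K = (THE A. clinear_op A \<and> (\<forall>c d. cinner (ket c) (A (ket d)) = K c d))"

definition ketbra :: "'a \<Rightarrow> 'a \<Rightarrow> 'a op" where
  "ketbra a b = matrix_op (\<lambda>c d. if c = a \<and> d = b then 1 else 0)"

definition positive :: "'a op \<Rightarrow> bool" where
  "positive A \<longleftrightarrow> clinear_op A \<and> (\<forall>\<psi>. cinner \<psi> (A \<psi>) \<in> \<real>\<^sub>\<ge>\<^sub>0)"

definition lowner_le :: "'a op \<Rightarrow> 'a op \<Rightarrow> bool" where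
  "lowner_le A B \<longleftrightarrow> positive (B - A)"

(* For a positive operator the trace is the sum of its (nonnegative) diagonal entries. *)
definition trace_le_1 :: "'a op \<Rightarrow> bool" where
  "trace_le_1 A \<longleftrightarrow> (\<lambda>c. cinner (ket c) (A (ket c))) summable_on UNIV
     \<and> Re (\<Sum>\<^sub>\<infinity>c. cinner (ket c) (A (ket c))) \<le> 1"

definition sandwich :: "'a op \<Rightarrow> 'a op \<Rightarrow> 'a op \<Rightarrow> 'a op" where
  "sandwich A B \<rho> = A o\<^sub>L \<rho> o\<^sub>L B"

section \<open>Quantum variables and their state spaces\<close>

datatype 'v qvar = BoolVar 'v | IntVar 'v

fun qdom :: "'v qvar \<Rightarrow> int set" where
  "qdom (BoolVar _) = {0, 1}"
| "qdom (IntVar _) = UNIV"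

(* The space of a finite set W of variables, i.e. the tensor product of the spaces of its members,
   is the space of square-summable functions on the product basis: the assignments of basis values
   to the variables in W. For all W these spaces sit inside one type, as the vectors supported on
   qbasis W, and operators on them are the operators on that type that live on this subspace. *)
definition qbasis :: "'v qvar set \<Rightarrow> ('v qvar \<Rightarrow> int) set" where
  "qbasis W = PiE W qdom"

definition qspace :: "'v qvar set \<Rightarrow> ('v qvar \<Rightarrow> int) ell2 set" where
  "qspace W = {\<psi>. \<forall>c. c \<notin> qbasis W \<longrightarrow> coeff \<psi> c = 0}"

type_synonym 'v qop = "('v qvar \<Rightarrow> int) op"

definition op_on :: "'v qvar set \<Rightarrow> 'v qop \<Rightarrow> bool" where
  "op_on W A \<longleftrightarrow> clinear_op A \<and> (\<forall>\<psi>. A \<psi> \<in> qspace W) \<and> (\<forall>c. c \<notin> qbasis W \<longrightarrow> A (ket c) = 0)"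

definition unitary_on :: "'v qvar set \<Rightarrow> 'v qop \<Rightarrow> bool" where
  "unitary_on W U \<longleftrightarrow> op_on W U \<and> (\<forall>\<psi>\<in>qspace W. adj U (U \<psi>) = \<psi> \<and> U (adj U \<psi>) = \<psi>)"

(* The series of the M_m^* M_m is taken in the strong operator topology; for infinitely many
   outcomes it does not converge in norm in general. *)
definition measurement_on :: "'v qvar set \<Rightarrow> 'm set \<Rightarrow> ('m \<Rightarrow> 'v qop) \<Rightarrow> bool" where
  "measurement_on W ms M \<longleftrightarrow> (\<forall>m\<in>ms. op_on W (M m))
     \<and> (\<forall>\<psi>\<in>qspace W. ((\<lambda>m. adj (M m) (M m \<psi>)) has_sum \<psi>) ms)"

definition partial_density :: "'v qvar set \<Rightarrow> 'v qop \<Rightarrow> bool" where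
  "partial_density V \<rho> \<longleftrightarrow> op_on V \<rho> \<and> positive \<rho> \<and> trace_le_1 \<rho>"

(* For A on the space of W, with W a subset of V: the tensor product of A with the identity on
   V - W, given by its matrix in the product basis. *)
definition ext :: "'v qvar set \<Rightarrow> 'v qvar set \<Rightarrow> 'v qop \<Rightarrow> 'v qop" where
  "ext V W A = matrix_op (\<lambda>c d.
     if c \<in> qbasis V \<and> d \<in> qbasis V \<and> restrict c (V - W) = restrict d (V - W)
     then cinner (ket (restrict c W)) (A (ket (restrict d W))) else 0)"

definition qketbra :: "'v qvar \<Rightarrow> int \<Rightarrow> int \<Rightarrow> 'v qop" where
  "qketbra q i j = ketbra (\<lambda>x\<in>{q}. i) (\<lambda>x\<in>{q}. j)"

section \<open>Statements\<close>

(* Cond qs ms M P is the if statement for the measurement M on qs with outcome set ms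
   (finite or infinite) and branches P m; only the values of M and P on ms matter.
   An operator on a tuple qs acts on the tensor product of the spaces labelled by the variables
   in qs, so the order of qs carries no information. Call i refers to entry i of the list of
   procedure bodies, counted from 0. *)
datatype ('v, 'm) stmt =
    Bottom
  | Skip
  | Init "'v qvar"
  | Unitary "'v qvar list" "'v qop"
  | Seq "('v, 'm) stmt" "('v, 'm) stmt"
  | Cond "'v qvar list" "'m set" "'m \<Rightarrow> 'v qop" "'m \<Rightarrow> ('v, 'm) stmt"
  | Call nat

primrec wf_stmt :: "nat \<Rightarrow> ('v, 'm) stmt \<Rightarrow> bool" where
  "wf_stmt n Bottom \<longleftrightarrow> True"
| "wf_stmt n Skip \<longleftrightarrow> True"
| "wf_stmt n (Init q) \<longleftrightarrow> True"
| "wf_stmt n (Unitary qs U) \<longleftrightarrow> distinct qs \<and> unitary_on (set qs) U"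
| "wf_stmt n (Seq S T) \<longleftrightarrow> wf_stmt n S \<and> wf_stmt n T"
| "wf_stmt n (Cond qs ms M P) \<longleftrightarrow> distinct qs \<and> measurement_on (set qs) ms M
     \<and> (\<forall>m\<in>ms. wf_stmt n (P m))"
| "wf_stmt n (Call i) \<longleftrightarrow> i < n"

(* The variables of a statement, including those of the procedures that it calls directly or
   indirectly. *)
inductive_set qvars :: "('v, 'm) stmt list \<Rightarrow> ('v qvar \<times> ('v, 'm) stmt) set"
  for D :: "('v, 'm) stmt list" where
  "(q, Init q) \<in> qvars D"
| "q \<in> set qs \<Longrightarrow> (q, Unitary qs U) \<in> qvars D"
| "(q, S) \<in> qvars D \<Longrightarrow> (q, Seq S T) \<in> qvars D"
| "(q, T) \<in> qvars D \<Longrightarrow> (q, Seq S T) \<in> qvars D"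
| "q \<in> set qs \<Longrightarrow> (q, Cond qs ms M P) \<in> qvars D"
| "m \<in> ms \<Longrightarrow> (q, P m) \<in> qvars D \<Longrightarrow> (q, Cond qs ms M P) \<in> qvars D"
| "i < length D \<Longrightarrow> (q, D ! i) \<in> qvars D \<Longrightarrow> (q, Call i) \<in> qvars D"

definition vars_of :: "('v, 'm) stmt list \<Rightarrow> ('v, 'm) stmt \<Rightarrow> 'v qvar set" where
  "vars_of D S = {q. (q, S) \<in> qvars D}"

section \<open>Denotational semantics\<close>

type_synonym 'v superop = "'v qop \<Rightarrow> 'v qop"

definition init_superop :: "'v qvar set \<Rightarrow> 'v qvar \<Rightarrow> 'v superop" where
  "init_superop V q \<rho> =
     (\<Sum>\<^sub>\<infinity>i\<in>qdom q. sandwich (ext V {q} (qketbra q 0 i)) (ext V {q} (qketbra q i 0)) \<rho>)"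

definition conj_superop :: "'v qvar set \<Rightarrow> 'v qvar list \<Rightarrow> 'v qop \<Rightarrow> 'v superop" where
  "conj_superop V qs A = sandwich (ext V (set qs) A) (adj (ext V (set qs) A))"

(* The pointwise least upper bound, in the order of partial density operators. *)
definition superop_lub :: "'v qvar set \<Rightarrow> (nat \<Rightarrow> 'v superop) \<Rightarrow> 'v superop" where
  "superop_lub V E \<rho> = (THE \<sigma>. partial_density V \<sigma> \<and> (\<forall>k. lowner_le (E k \<rho>) \<sigma>)
     \<and> (\<forall>\<tau>. partial_density V \<tau> \<and> (\<forall>k. lowner_le (E k \<rho>) \<tau>) \<longrightarrow> lowner_le \<sigma> \<tau>))"

(* Semantics over the quantum variables V, relative to a given meaning \<eta> of procedure calls. *)
primrec den :: "'v qvar set \<Rightarrow> (nat \<Rightarrow> 'v superop) \<Rightarrow> ('v, 'm) stmt \<Rightarrow> 'v superop" where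
  "den V \<eta> Bottom = sandwich 0 0"
| "den V \<eta> Skip = sandwich id_blinfun id_blinfun"
| "den V \<eta> (Init q) = init_superop V q"
| "den V \<eta> (Unitary qs U) = conj_superop V qs U"
| "den V \<eta> (Seq S T) = den V \<eta> T \<circ> den V \<eta> S"
| "den V \<eta> (Cond qs ms M P) =
     (\<lambda>\<rho>. \<Sum>\<^sub>\<infinity>m\<in>ms. (den V \<eta> (P m) \<circ> conj_superop V qs (M m)) \<rho>)"
| "den V \<eta> (Call i) = \<eta> i"

primrec subst_calls :: "(nat \<Rightarrow> ('v, 'm) stmt) \<Rightarrow> ('v, 'm) stmt \<Rightarrow> ('v, 'm) stmt" where
  "subst_calls f Bottom = Bottom"
| "subst_calls f Skip = Skip"
| "subst_calls f (Init q) = Init q"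
| "subst_calls f (Unitary qs U) = Unitary qs U"
| "subst_calls f (Seq S T) = Seq (subst_calls f S) (subst_calls f T)"
| "subst_calls f (Cond qs ms M P) = Cond qs ms M (\<lambda>m. subst_calls f (P m))"
| "subst_calls f (Call i) = f i"

primrec approx :: "('v, 'm) stmt list \<Rightarrow> nat \<Rightarrow> nat \<Rightarrow> ('v, 'm) stmt" where
  "approx D 0 i = Bottom"
| "approx D (Suc k) i = subst_calls (\<lambda>j. Seq Skip (approx D k j)) (D ! i)"

(* The approximants contain no calls, so the meaning of calls supplied for them is irrelevant. *)
definition denot :: "'v qvar set \<Rightarrow> ('v, 'm) stmt list \<Rightarrow> ('v, 'm) stmt \<Rightarrow> 'v superop" where
  "denot V D = den V (\<lambda>i. superop_lub V (\<lambda>k. den V (\<lambda>_ _. 0) (approx D k i)))"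

section \<open>Operational semantics\<close>

datatype 'm label = Eps | Outcome 'm

(* None is the empty statement E; Fail is the failure state. *)
datatype ('v, 'm) config = Conf "('v, 'm) stmt option" "'v qop" | Fail

inductive proper_step ::
  "'v qvar set \<Rightarrow> ('v, 'm) stmt list \<Rightarrow> ('v, 'm) stmt option \<Rightarrow> 'v qop \<Rightarrow> 'm label
     \<Rightarrow> ('v, 'm) stmt option \<Rightarrow> 'v qop \<Rightarrow> bool"
  for V :: "'v qvar set" and D :: "('v, 'm) stmt list" where
  "proper_step V D (Some Bottom) \<rho> Eps None 0"
| "proper_step V D (Some Skip) \<rho> Eps None \<rho>"
| "proper_step V D (Some (Init q)) \<rho> Eps None (init_superop V q \<rho>)"
| "proper_step V D (Some (Unitary qs U)) \<rho> Eps None (conj_superop V qs U \<rho>)"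
| "proper_step V D (Some S) \<rho> l (Some S') \<rho>'
     \<Longrightarrow> proper_step V D (Some (Seq S T)) \<rho> l (Some (Seq S' T)) \<rho>'"
| "proper_step V D (Some S) \<rho> l None \<rho>'
     \<Longrightarrow> proper_step V D (Some (Seq S T)) \<rho> l (Some T) \<rho>'"
| "m \<in> ms \<Longrightarrow> proper_step V D (Some (Cond qs ms M P)) \<rho> (Outcome m)
     (Some (P m)) (conj_superop V qs (M m) \<rho>)"
| "i < length D \<Longrightarrow> proper_step V D (Some (Call i)) \<rho> Eps (Some (D ! i)) \<rho>"

inductive step ::
  "'v qvar set \<Rightarrow> ('v, 'm) stmt list \<Rightarrow> ('v, 'm) stmt option \<Rightarrow> 'v qop \<Rightarrow> 'm label
     \<Rightarrow> ('v, 'm) config \<Rightarrow> bool"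
  for V :: "'v qvar set" and D :: "('v, 'm) stmt list" where
  "proper_step V D S \<rho> l S' \<rho>' \<Longrightarrow> step V D S \<rho> l (Conf S' \<rho>')"
| "(\<nexists>S' \<rho>'. proper_step V D S \<rho> l S' \<rho>') \<Longrightarrow> step V D S \<rho> l Fail"

inductive steps ::
  "'v qvar set \<Rightarrow> ('v, 'm) stmt list \<Rightarrow> ('v, 'm) stmt option \<Rightarrow> 'v qop \<Rightarrow> 'm label list
     \<Rightarrow> ('v, 'm) config \<Rightarrow> bool"
  for V :: "'v qvar set" and D :: "('v, 'm) stmt list" where
  "step V D S \<rho> l C \<Longrightarrow> steps V D S \<rho> [l] C"
| "steps V D S \<rho> \<alpha>\<^sub>1 (Conf S'' \<rho>'') \<Longrightarrow> steps V D S'' \<rho>'' \<alpha>\<^sub>2 C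
     \<Longrightarrow> steps V D S \<rho> (\<alpha>\<^sub>1 @ \<alpha>\<^sub>2) C"

lemma proper_step_deterministic:
  assumes "proper_step V D S \<rho> l S' \<rho>'" and "proper_step V D S \<rho> l S'' \<rho>''"
  shows "S' = S'' \<and> \<rho>' = \<rho>''"
  using assms
proof (induction arbitrary: S'' \<rho>'' rule: proper_step.induct)
  case (5 S \<rho> l S' \<rho>' T)
  show ?case
    using "5.prems" by cases (use "5.IH" in blast)+
next
  case (6 S \<rho> l \<rho>' T)
  show ?case
    using "6.prems" by cases (use "6.IH" in blast)+
qed (auto elim: proper_step.cases)

lemma step_deterministic:
  assumes "step V D S \<rho> l C" and "step V D S \<rho> l C'"
  shows "C = C'"
  using assms by (auto elim!: step.cases dest: proper_step_deterministic)

lemma steps_nonempty: "steps V D S \<rho> \<alpha> C \<Longrightarrow> \<alpha> \<noteq> []"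
  by (induction rule: steps.induct) auto

lemma steps_first:
  assumes "steps V D S \<rho> \<alpha> C"
  shows "(\<exists>l. \<alpha> = [l] \<and> step V D S \<rho> l C) \<or>
    (\<exists>l \<beta> S'' \<rho>''. \<alpha> = l # \<beta> \<and> \<beta> \<noteq> [] \<and> step V D S \<rho> l (Conf S'' \<rho>'') \<and> steps V D S'' \<rho>'' \<beta> C)"
  using assms
proof (induction rule: steps.induct)
  case (2 S \<rho> \<alpha>\<^sub>1 S'' \<rho>'' \<alpha>\<^sub>2 C)
  have ne: "\<alpha>\<^sub>2 \<noteq> []"
    using "2.hyps"(2) by (rule steps_nonempty)
  from "2.IH"(1) show ?case
  proof (elim disjE exE conjE)
    fix l assume "\<alpha>\<^sub>1 = [l]" "step V D S \<rho> l (Conf S'' \<rho>'')"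
    then show ?thesis using ne "2.hyps"(2) by auto
  next
    fix l \<beta> T \<sigma>
    assume *: "\<alpha>\<^sub>1 = l # \<beta>" "step V D S \<rho> l (Conf T \<sigma>)" "steps V D T \<sigma> \<beta> (Conf S'' \<rho>'')"
    from *(3) "2.hyps"(2) have "steps V D T \<sigma> (\<beta> @ \<alpha>\<^sub>2) C"
      by (rule steps.intros)
    then show ?thesis using * ne by auto
  qed
qed auto

(* A label sequence determines the configuration reached; in particular the final state. *)
lemma steps_deterministic:
  "steps V D S \<rho> \<alpha> C \<Longrightarrow> steps V D S \<rho> \<alpha> C' \<Longrightarrow> C = C'"
proof (induction \<alpha> arbitrary: S \<rho>)
  case Nil
  then show ?case using steps_nonempty by blast
next
  case (Cons l \<beta>)
  show ?case
    using steps_first[OF Cons.prems(1)] steps_first[OF Cons.prems(2)] Cons.IH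
    by (auto dest: step_deterministic)
qed

end

theory Submission
  imports Defs
begin

text \<open>The control flow of a program does not depend on the quantum state, so a terminating computation
from \<open>S\<close> is a label sequence together with a superoperator, and these label sequences form a
prefix-free set. Structural induction shows that \<open>den V \<eta> S\<close> is the sum of the superoperators of
the computations of \<open>S\<close> whenever each \<open>\<eta> i\<close> is the sum for a set \<open>X i\<close> of computations of
\<open>Call i\<close>. This single statement is used twice: the \<open>k\<close>-th approximant of a call corresponds to the
computations of call depth at most \<open>k\<close>, these sets increase to the set of all terminating
computations, and the least upper bound of the partial sums is the full sum, so that it also
applies to the semantics of calls itself.

All sums converge in norm because the operators involved are positive with summable traces and a
positive operator is bounded in norm by its trace. That measurements, unitaries and initializations do
not increase the trace needs no square root of the state: by a finite Cholesky decomposition a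
positive operator is a sum of rank one operators up to a remainder of arbitrarily small trace.\<close>

section \<open>The Hilbert space of square-summable functions\<close>

text \<open>The definitions rely on descriptions and on sums with a default: \<open>adj\<close>,
  \<open>matrix_op\<close> and \<open>superop_lub\<close> are given by \<open>THE\<close>, and
  \<open>infsum\<close> is 0 when a series diverges. Existence and uniqueness therefore precede
  every computation, and the induction carries \<open>has_sum\<close> statements instead of
  equations between sums.

  For positive operators the trace turns an operator series into a nonnegative real one, where
  bounded finite partial sums give convergence and iterated sums can be exchanged. Of a
  superoperator the induction keeps additivity and the fact that it maps partial densities to
  partial densities without raising the trace; countable additivity follows from these.

  Prefix-freeness is what makes sums over label sequences compatible with \<open>Seq S T\<close>: a
  sequence splits in exactly one way, so no two pairs of computations merge into one term. Effects
  are stored as functions of the state because the second factor of a composition is applied to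
  intermediate states.\<close>

lemma coeff_eqI: "(\<And>c. coeff f c = coeff g c) \<Longrightarrow> f = g"
  by (simp add: coeff_inject[symmetric] fun_eq_iff)

lemma coeff_simps [simp]:
  "coeff 0 c = 0"
  "coeff (f + g) c = coeff f c + coeff g c"
  "coeff (f - g) c = coeff f c - coeff g c"
  "coeff (- f) c = - coeff f c"
  "coeff (r *\<^sub>R f) c = r *\<^sub>R coeff f c"
  "coeff (scaleC z f) c = z * coeff f c"
  "coeff (ket a) c = (if c = a then 1 else 0)"
  by (simp_all add: zero_ell2.rep_eq plus_ell2.rep_eq minus_ell2.rep_eq uminus_ell2.rep_eq
      scaleR_ell2.rep_eq scaleC.rep_eq ket.rep_eq)

lemma coeff_sum [simp]: "coeff (sum f F) c = (\<Sum>x\<in>F. coeff (f x) c)"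
  by (induction F rule: infinite_finite_induct) simp_all

lemma coeff_square_summable: "(\<lambda>x. (cmod (coeff f x))\<^sup>2) summable_on A"
  using coeff[of f] summable_on_subset_banach[of _ UNIV A] by auto

lemma norm_ell2_square: "(norm f)\<^sup>2 = (\<Sum>\<^sub>\<infinity>x. (cmod (coeff f x))\<^sup>2)"
  by (simp add: power2_norm_eq_inner inner_ell2.rep_eq)

lemma has_sum_norm_ell2: "((\<lambda>x. (cmod (coeff f x))\<^sup>2) has_sum (norm f)\<^sup>2) UNIV"
  unfolding norm_ell2_square by (rule has_sum_infsum[OF coeff_square_summable])

lemma cinner_summable: "(\<lambda>x. cnj (coeff f x) * coeff g x) summable_on A"
  by (rule abs_summable_summable)
    (use ell2_inner_summable[OF coeff_square_summable[of f A] coeff_square_summable[of g]] in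
      \<open>simp add: norm_mult\<close>)

lemma cinner_has_sum: "((\<lambda>x. cnj (coeff f x) * coeff g x) has_sum cinner f g) UNIV"
  unfolding cinner.rep_eq by (rule has_sum_infsum[OF cinner_summable])

lemma cinner_cnj: "cnj (cinner f g) = cinner g f"
  by (simp add: cinner.rep_eq infsum_cnj[symmetric] mult.commute del: infsum_cnj)

lemma cinner_add_right: "cinner f (g + h) = cinner f g + cinner f h"
  by (simp add: cinner.rep_eq distrib_left infsum_add cinner_summable)

lemma cinner_scaleC_right: "cinner f (scaleC z g) = z * cinner f g"
  by (simp add: cinner.rep_eq mult.left_commute infsum_cmult_right')

lemma cinner_ket [simp]: "cinner (ket c) f = coeff f c"
proof -
  have "((\<lambda>x. cnj (coeff (ket c) x) * coeff f x) has_sum coeff f c) UNIV"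
    by (rule has_sum_finite_neutralI[where B = "{c}"]) auto
  then show ?thesis
    using cinner_has_sum has_sum_unique by blast
qed

lemma cinner_ket_right [simp]: "cinner f (ket c) = cnj (coeff f c)"
  by (metis cinner_cnj cinner_ket)

lemma Re_cinner: "Re (cinner f g) = inner f g"
  by (simp add: cinner.rep_eq inner_ell2.rep_eq infsum_Re[symmetric] cinner_summable inner_complex_def)

lemma cinner_self: "cinner f f = of_real ((norm f)\<^sup>2)"
proof -
  have "((\<lambda>x. of_real ((cmod (coeff f x))\<^sup>2) :: complex) has_sum of_real ((norm f)\<^sup>2)) UNIV"
    using has_sum_norm_ell2 by (simp only: has_sum_of_real_iff)
  moreover have "complex_of_real ((cmod z)\<^sup>2) = cnj z * z" for z
    by (subst complex_norm_square) (rule mult.commute)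
  ultimately show ?thesis
    using cinner_has_sum[of f f] has_sum_unique by (simp only:) blast
qed

lemma norm_scaleC: "norm (scaleC z f) = cmod z * norm f"
proof -
  have "(norm (scaleC z f))\<^sup>2 = (cmod z * norm f)\<^sup>2"
    by (simp add: norm_ell2_square norm_mult power_mult_distrib infsum_cmult_right')
  then show ?thesis
    by (simp add: power2_eq_iff_nonneg)
qed

lemma cinner_bound: "cmod (cinner f g) \<le> norm f * norm g"
proof (cases "cinner f g = 0")
  case False
  \<comment> \<open>Multiplying \<open>g\<close> by the phase \<open>z\<close> makes the complex
    inner product real and nonnegative, so the Cauchy-Schwarz inequality of the real inner product
    applies.\<close>
  define z where "z = cnj (cinner f g) / cmod (cinner f g)"
  have z: "cmod z = 1"
    using False by (simp add: z_def norm_divide)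
  have "Re (z * cinner f g) = cmod (cinner f g)"
    using False by (simp add: z_def mult.commute[of "cnj _"] complex_norm_square[symmetric]
        power2_eq_square)
  then have "cmod (cinner f g) = inner f (scaleC z g)"
    by (simp add: Re_cinner[symmetric] cinner_scaleC_right)
  also have "\<dots> \<le> norm f * norm (scaleC z g)"
    by (rule norm_cauchy_schwarz)
  finally show ?thesis
    by (simp add: norm_scaleC z)
qed simp

lemma bounded_linear_cinner_right: "bounded_linear (cinner f)"
proof
  show "cinner f (r *\<^sub>R g) = r *\<^sub>R cinner f g" for r g
    using cinner_scaleC_right[of f "of_real r" g]
    by (simp add: scaleR_conv_of_real cinner.rep_eq)
  show "\<exists>K. \<forall>g. norm (cinner f g) \<le> norm g * K"
    using cinner_bound[of f] by (auto intro!: exI[of _ "norm f"] simp: mult.commute[of "norm f"])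
qed (rule cinner_add_right)

lemma bounded_linear_cinner_left: "bounded_linear (\<lambda>f. cinner f g)"
  using bounded_linear_compose[OF bounded_linear_cnj bounded_linear_cinner_right[of g]]
  by (simp add: cinner_cnj)

lemmas cinner_simps =
  bounded_linear.linear[OF bounded_linear_cinner_right, THEN linear_add]
  bounded_linear.linear[OF bounded_linear_cinner_left, THEN linear_add]
  bounded_linear.linear[OF bounded_linear_cinner_right, THEN linear_diff]
  bounded_linear.linear[OF bounded_linear_cinner_left, THEN linear_diff]
  bounded_linear.linear[OF bounded_linear_cinner_right, THEN linear_0]
  bounded_linear.linear[OF bounded_linear_cinner_left, THEN linear_0]
  bounded_linear.linear[OF bounded_linear_cinner_right, THEN linear_sum]
  cinner_scaleC_right

lemma cinner_scaleC_left: "cinner (scaleC z f) g = cnj z * cinner f g"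
  by (metis cinner_cnj cinner_scaleC_right complex_cnj_mult)

lemma bounded_linear_coeff: "bounded_linear (\<lambda>f. coeff f c)"
proof -
  have "(\<lambda>f. coeff f c) = cinner (ket c)"
    by (simp add: fun_eq_iff)
  then show ?thesis
    using bounded_linear_cinner_right by metis
qed

lemma norm_ket [simp]: "norm (ket c) = 1"
  using norm_ge_zero[of "ket c"] cinner_self[of "ket c"]
  by (auto simp: power2_eq_1_iff simp del: of_real_power norm_ge_zero)

lemma sum_coeff_square_le: "finite F \<Longrightarrow> (\<Sum>c\<in>F. (cmod (coeff f c))\<^sup>2) \<le> (norm f)\<^sup>2"
  by (rule finite_sum_le_has_sum[OF has_sum_norm_ell2]) auto

section \<open>Completeness and expansion in the basis\<close>

text \<open>Completeness of this space makes the bounded operators on it a Banach space, in which a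
  series with summable norms converges.\<close>

instance ell2 :: (type) banach
proof
  fix X :: "nat \<Rightarrow> 'a ell2"
  assume X: "Cauchy X"
  have "convergent (\<lambda>n. coeff (X n) c)" for c
    using bounded_linear.Cauchy[OF bounded_linear_coeff X]
    by (rule Cauchy_convergent)
  then obtain l where l: "\<And>c. (\<lambda>n. coeff (X n) c) \<longlonglongrightarrow> l c"
    unfolding convergent_def by metis
  \<comment> \<open>On a finite set \<open>F\<close> the limit can be taken coordinate by
    coordinate. The bound is uniform in \<open>F\<close>, so it passes to the whole square
    sum.\<close>
  have tail: "\<exists>N. \<forall>n\<ge>N. \<forall>F. finite F \<longrightarrow> (\<Sum>c\<in>F. (cmod (coeff (X n) c - l c))\<^sup>2) \<le> e\<^sup>2"
    if "e > 0" for e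
  proof -
    obtain N where N: "\<And>m n. m \<ge> N \<Longrightarrow> n \<ge> N \<Longrightarrow> norm (X m - X n) < e"
      using CauchyD[OF X \<open>e > 0\<close>] by blast
    have "(\<Sum>c\<in>F. (cmod (coeff (X n) c - l c))\<^sup>2) \<le> e\<^sup>2" if "n \<ge> N" "finite F" for n F
    proof (rule LIMSEQ_le_const2)
      show "(\<lambda>m. \<Sum>c\<in>F. (cmod (coeff (X n) c - coeff (X m) c))\<^sup>2)
          \<longlonglongrightarrow> (\<Sum>c\<in>F. (cmod (coeff (X n) c - l c))\<^sup>2)"
        by (intro tendsto_intros l)
      have "(\<Sum>c\<in>F. (cmod (coeff (X n) c - coeff (X m) c))\<^sup>2) \<le> e\<^sup>2" if "m \<ge> N" for m
        using sum_coeff_square_le[OF \<open>finite F\<close>, of "X n - X m"]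
          power_mono[of "norm (X n - X m)" e 2] N[of n m] that \<open>n \<ge> N\<close> by simp
      then show "\<exists>M. \<forall>m\<ge>M. (\<Sum>c\<in>F. (cmod (coeff (X n) c - coeff (X m) c))\<^sup>2) \<le> e\<^sup>2"
        by blast
    qed
    then show ?thesis by blast
  qed
  have sq: "(\<lambda>c. (cmod (l c - coeff (X n) c))\<^sup>2) summable_on UNIV"
    if "\<forall>F. finite F \<longrightarrow> (\<Sum>c\<in>F. (cmod (coeff (X n) c - l c))\<^sup>2) \<le> e\<^sup>2" for n e
    by (rule nonneg_bdd_above_summable_on)
      (use that in \<open>auto simp: norm_minus_commute intro!: bdd_aboveI2[where M = "e\<^sup>2"]\<close>)
  obtain N1 where
    N1: "\<forall>n\<ge>N1. \<forall>F. finite F \<longrightarrow> (\<Sum>c\<in>F. (cmod (coeff (X n) c - l c))\<^sup>2) \<le> 1\<^sup>2"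
    using tail[of 1] by auto
  define L where "L = Abs_ell2 l"
  \<comment> \<open>The pointwise limit differs from the member \<open>X N1\<close> by a
    square-summable function, so it is square-summable itself.\<close>
  have "(\<lambda>c. (cmod ((l c - coeff (X N1) c) + coeff (X N1) c))\<^sup>2) summable_on UNIV"
    by (rule ell2_add_closed[OF sq coeff_square_summable]) (use N1 in blast)
  then have L: "coeff L = l"
    by (simp add: L_def Abs_ell2_inverse)
  have "X \<longlonglongrightarrow> L"
  proof (rule LIMSEQ_I)
    fix r :: real
    assume "r > 0"
    then obtain N where
      N: "\<forall>n\<ge>N. \<forall>F. finite F \<longrightarrow> (\<Sum>c\<in>F. (cmod (coeff (X n) c - l c))\<^sup>2) \<le> (r / 2)\<^sup>2"
      using tail[of "r / 2"] by auto
    have "norm (X n - L) < r" if "n \<ge> N" for n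
    proof -
      have "(norm (X n - L))\<^sup>2 \<le> (r / 2)\<^sup>2"
        using has_sum_norm_ell2[of "X n - L"]
        by (rule has_sum_le_finite_sums) (use N that in \<open>simp add: L\<close>)
      then have "norm (X n - L) \<le> r / 2"
        using \<open>r > 0\<close> by (simp add: abs_le_square_iff[symmetric])
      then show ?thesis
        using \<open>r > 0\<close> by simp
    qed
    then show "\<exists>no. \<forall>n\<ge>no. norm (X n - L) < r" by blast
  qed
  then show "convergent X" by (rule convergentI)
qed

text \<open>By Pythagoras the remainder outside a finite set has as squared norm the missing part of
  the square sum, which tends to 0.\<close>

lemma ket_expansion: "((\<lambda>c. scaleC (coeff \<psi> c) (ket c)) has_sum \<psi>) UNIV"
  unfolding has_sum_def
proof (rule tendstoI)
  fix e :: real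
  assume "e > 0"
  have "\<forall>\<^sub>F F in finite_subsets_at_top UNIV.
      dist (\<Sum>c\<in>F. (cmod (coeff \<psi> c))\<^sup>2) ((norm \<psi>)\<^sup>2) < e\<^sup>2"
    using has_sum_norm_ell2[of \<psi>] \<open>e > 0\<close> unfolding has_sum_def by (intro tendstoD) auto
  moreover have "\<forall>\<^sub>F F in finite_subsets_at_top (UNIV :: 'a set). finite F"
    by (rule eventually_finite_subsets_at_top_weakI)
  ultimately show "\<forall>\<^sub>F F in finite_subsets_at_top UNIV.
      dist (\<Sum>c\<in>F. scaleC (coeff \<psi> c) (ket c)) \<psi> < e"
  proof eventually_elim
    case (elim F)
    define \<phi> where "\<phi> = \<psi> - (\<Sum>c\<in>F. scaleC (coeff \<psi> c) (ket c))"
    have \<phi>: "coeff \<phi> c = (if c \<in> F then 0 else coeff \<psi> c)" for c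
      using elim(2) by (simp add: \<phi>_def if_distrib[of "\<lambda>x. _ * x"] sum.delta cong: if_cong)
    have "((\<lambda>c. (cmod (coeff \<psi> c))\<^sup>2 - (cmod (coeff \<phi> c))\<^sup>2) has_sum
        ((norm \<psi>)\<^sup>2 - (norm \<phi>)\<^sup>2)) UNIV"
      using has_sum_add[OF has_sum_norm_ell2[of \<psi>] has_sum_uminusI[OF has_sum_norm_ell2[of \<phi>]]]
      by simp
    moreover have "((\<lambda>c. (cmod (coeff \<psi> c))\<^sup>2 - (cmod (coeff \<phi> c))\<^sup>2) has_sum
        (\<Sum>c\<in>F. (cmod (coeff \<psi> c))\<^sup>2)) UNIV"
      by (rule has_sum_finite_neutralI[where B = F]) (use elim(2) in \<open>auto simp: \<phi>\<close>)
    ultimately have "(norm \<psi>)\<^sup>2 - (norm \<phi>)\<^sup>2 = (\<Sum>c\<in>F. (cmod (coeff \<psi> c))\<^sup>2)"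
      by (rule has_sum_unique)
    then have "(norm \<phi>)\<^sup>2 < e\<^sup>2"
      using elim(1) by (simp add: dist_real_def)
    then have "norm \<phi> < e"
      using \<open>e > 0\<close> by (simp add: power2_less_imp_less)
    then show ?case
      by (simp add: dist_norm norm_minus_commute \<phi>_def)
  qed
qed

section \<open>Complex linear operators and their matrices\<close>

lemma clinear_opD: "clinear_op A \<Longrightarrow> blinfun_apply A (scaleC z \<psi>) = scaleC z (blinfun_apply A \<psi>)"
  by (simp add: clinear_op_def)

lemma op_expansion:
  assumes "clinear_op A"
  shows "((\<lambda>c. scaleC (coeff \<psi> c) (blinfun_apply A (ket c))) has_sum blinfun_apply A \<psi>) UNIV"
  using has_sum_bounded_linear[OF blinfun.bounded_linear_right ket_expansion, of A \<psi>]
  by (simp add: clinear_opD[OF assms] o_def)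

lemma clinear_op_eqI:
  assumes "clinear_op A" "clinear_op B" "\<And>c. blinfun_apply A (ket c) = blinfun_apply B (ket c)"
  shows "A = B"
proof (rule blinfun_eqI)
  fix \<psi>
  have "((\<lambda>c. scaleC (coeff \<psi> c) (blinfun_apply A (ket c))) has_sum blinfun_apply B \<psi>) UNIV"
    unfolding assms(3) by (rule op_expansion[OF assms(2)])
  then show "blinfun_apply A \<psi> = blinfun_apply B \<psi>"
    using op_expansion[OF assms(1)] has_sum_unique by blast
qed

lemma clinear_op_matrix_eqI:
  assumes "clinear_op A" "clinear_op B"
    "\<And>c d. coeff (blinfun_apply A (ket d)) c = coeff (blinfun_apply B (ket d)) c"
  shows "A = B"
  by (rule clinear_op_eqI[OF assms(1,2)]) (rule coeff_eqI, rule assms(3))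

text \<open>A bounded operator is determined by its matrix, so exhibiting one with the entries
  \<open>K\<close> evaluates the description. Each use has to supply such an operator, that is, a
  proof of boundedness.\<close>

lemma matrix_op_eqI:
  assumes "clinear_op A" "\<And>c d. coeff (blinfun_apply A (ket d)) c = K c d"
  shows "matrix_op K = A"
  unfolding matrix_op_def
  by (rule the_equality) (use assms in \<open>auto intro!: clinear_op_matrix_eqI\<close>)

lemma scaleC_of_real: "scaleC (of_real r) f = r *\<^sub>R f"
  by (rule coeff_eqI) (simp add: scaleR_conv_of_real)

lemma bounded_clinearI:
  assumes "\<And>f g. A (f + g) = A f + A g" "\<And>z f. A (scaleC z f) = scaleC z (A f)"
    "\<And>f. norm (A f) \<le> norm f * K"
  shows "bounded_linear A" "clinear_op (Blinfun A)" "blinfun_apply (Blinfun A) = A"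
proof -
  show *: "bounded_linear A"
    by (rule bounded_linear_intro[where K = K])
      (use assms assms(2)[of "of_real _"] in \<open>auto simp: scaleC_of_real\<close>)
  then show "clinear_op (Blinfun A)" "blinfun_apply (Blinfun A) = A"
    by (auto simp: clinear_op_def bounded_linear_Blinfun_apply assms(2))
qed

(* The coefficients of the adjoint are forced; testing A on the vector with these
   coefficients cut off to a finite set F bounds their square sum over F. *)
lemma adj_exists:
  assumes A: "clinear_op A"
  shows "\<exists>B. clinear_op B \<and> (\<forall>\<phi> \<psi>. cinner (blinfun_apply B \<phi>) \<psi> = cinner \<phi> (blinfun_apply A \<psi>))"
proof -
  define b where "b \<phi> c = cinner (blinfun_apply A (ket c)) \<phi>" for \<phi> c
  have bound: "(\<Sum>c\<in>F. (cmod (b \<phi> c))\<^sup>2) \<le> (norm A * norm \<phi>)\<^sup>2" if "finite F" for F \<phi>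
  proof -
    define v where "v = (\<Sum>c\<in>F. scaleC (b \<phi> c) (ket c))"
    define s where "s = (\<Sum>c\<in>F. (cmod (b \<phi> c))\<^sup>2)"
    have coeff_v: "coeff v c = (if c \<in> F then b \<phi> c else 0)" for c
      using that by (simp add: v_def if_distrib[of "\<lambda>x. _ * x"] sum.delta cong: if_cong)
    have "((\<lambda>c. (cmod (coeff v c))\<^sup>2) has_sum s) UNIV"
      by (rule has_sum_finite_neutralI[where B = F]) (use that in \<open>auto simp: coeff_v s_def\<close>)
    then have norm_v: "(norm v)\<^sup>2 = s"
      using has_sum_norm_ell2 has_sum_unique by blast
    have "cinner \<phi> (blinfun_apply A v) = (\<Sum>c\<in>F. b \<phi> c * cnj (b \<phi> c))"
      by (simp add: v_def blinfun.sum_right cinner_simps clinear_opD[OF A] b_def cinner_cnj)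
    also have "\<dots> = of_real s"
      by (simp add: s_def complex_norm_square del: of_real_power)
    finally have "s = cmod (cinner \<phi> (blinfun_apply A v))"
      by (simp only: norm_of_real) (simp add: s_def sum_nonneg)
    also have "\<dots> \<le> norm \<phi> * norm (blinfun_apply A v)"
      by (rule cinner_bound)
    also have "\<dots> \<le> norm \<phi> * (norm A * norm v)"
      by (intro mult_left_mono norm_blinfun) simp
    finally have "norm v * norm v \<le> (norm A * norm \<phi>) * norm v"
      by (simp add: norm_v[symmetric] power2_eq_square algebra_simps)
    then have "norm v \<le> norm A * norm \<phi>"
      by (cases "norm v = 0") auto
    then have "(norm v)\<^sup>2 \<le> (norm A * norm \<phi>)\<^sup>2"
      by (intro power_mono) auto
    then show ?thesis
      by (simp add: norm_v s_def)
  qed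
  have "(\<lambda>c. (cmod (b \<phi> c))\<^sup>2) summable_on UNIV" for \<phi>
    by (rule nonneg_bdd_above_summable_on)
      (use bound in \<open>auto intro!: bdd_aboveI2[where M = "(norm A * norm \<phi>)\<^sup>2"]\<close>)
  then have coeff_B: "coeff (Abs_ell2 (b \<phi>)) = b \<phi>" for \<phi>
    by (simp add: Abs_ell2_inverse)
  define B where "B \<phi> = Abs_ell2 (b \<phi>)" for \<phi>
  have "norm (B \<phi>) \<le> norm \<phi> * norm A" for \<phi>
  proof -
    have "(norm (B \<phi>))\<^sup>2 \<le> (norm A * norm \<phi>)\<^sup>2"
      by (rule has_sum_le_finite_sums[OF has_sum_norm_ell2]) (use bound in \<open>simp add: B_def coeff_B\<close>)
    then show ?thesis
      by (simp add: power_mono_iff mult.commute)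
  qed
  moreover have "B (\<phi> + \<psi>) = B \<phi> + B \<psi>" for \<phi> \<psi>
    by (rule coeff_eqI) (simp add: B_def coeff_B b_def cinner_simps)
  moreover have "B (scaleC z \<phi>) = scaleC z (B \<phi>)" for z \<phi>
    by (rule coeff_eqI) (simp add: B_def coeff_B b_def cinner_simps)
  ultimately have B: "clinear_op (Blinfun B)" "blinfun_apply (Blinfun B) = B"
    using bounded_clinearI(2,3)[of B "norm A"] by blast+
  have "cinner (B \<phi>) \<psi> = cinner \<phi> (blinfun_apply A \<psi>)" for \<phi> \<psi>
  proof -
    have "((\<lambda>c. cinner \<phi> (scaleC (coeff \<psi> c) (blinfun_apply A (ket c))))
        has_sum cinner \<phi> (blinfun_apply A \<psi>)) UNIV"
      using has_sum_bounded_linear[OF bounded_linear_cinner_right op_expansion[OF A], of \<phi> \<psi>]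
      by (simp add: o_def)
    moreover have "cinner \<phi> (scaleC (coeff \<psi> c) (blinfun_apply A (ket c)))
        = cnj (coeff (B \<phi>) c) * coeff \<psi> c" for c
      by (simp add: B_def coeff_B b_def cinner_simps cinner_cnj)
    ultimately show ?thesis
      using cinner_has_sum[of "B \<phi>" \<psi>] has_sum_unique by fastforce
  qed
  then show ?thesis using B by metis
qed

lemma cinner_eqI: "(\<And>\<phi>. cinner \<phi> f = cinner \<phi> g) \<Longrightarrow> f = g"
  by (rule coeff_eqI) (metis cinner_ket)

lemma adj_eqI:
  assumes "clinear_op B" "\<And>\<phi> \<psi>. cinner (blinfun_apply B \<phi>) \<psi> = cinner \<phi> (blinfun_apply A \<psi>)"
  shows "adj A = B"
  unfolding adj_def
proof (rule the_equality)
  fix C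
  assume C: "clinear_op C \<and> (\<forall>\<phi> \<psi>. cinner (blinfun_apply C \<phi>) \<psi> = cinner \<phi> (blinfun_apply A \<psi>))"
  have "cinner \<psi> (blinfun_apply C \<phi>) = cinner \<psi> (blinfun_apply B \<phi>)" for \<phi> \<psi>
    using assms(2)[of \<phi> \<psi>] C by (metis cinner_cnj)
  then show "C = B"
    by (intro blinfun_eqI cinner_eqI)
qed (use assms in simp)

lemma
  assumes "clinear_op A"
  shows clinear_adj: "clinear_op (adj A)"
    and cinner_adj_left: "cinner (blinfun_apply (adj A) \<phi>) \<psi> = cinner \<phi> (blinfun_apply A \<psi>)"
  using adj_exists[OF assms] adj_eqI by metis+

lemma cinner_adj_right:
  "clinear_op A \<Longrightarrow> cinner \<phi> (blinfun_apply (adj A) \<psi>) = cinner (blinfun_apply A \<phi>) \<psi>"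
  by (metis cinner_adj_left cinner_cnj)

lemma coeff_adj:
  "clinear_op A \<Longrightarrow> coeff (blinfun_apply (adj A) (ket d)) c = cnj (coeff (blinfun_apply A (ket c)) d)"
  using cinner_adj_right[of A "ket c" "ket d"] by simp

lemma adj_matrix_eqI:
  assumes "clinear_op A" "clinear_op B"
    "\<And>c d. coeff (blinfun_apply B (ket d)) c = cnj (coeff (blinfun_apply A (ket c)) d)"
  shows "adj A = B"
  by (rule clinear_op_matrix_eqI) (use assms in \<open>auto simp: coeff_adj clinear_adj\<close>)

section \<open>Positive operators and the trace\<close>

abbreviation quad :: "'a op \<Rightarrow> 'a ell2 \<Rightarrow> real" where
  "quad A \<psi> \<equiv> inner \<psi> (blinfun_apply A \<psi>)"

definition diag :: "'a op \<Rightarrow> 'a \<Rightarrow> real" where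
  "diag A c = quad A (ket c)"

definition trace :: "'a op \<Rightarrow> real" where
  "trace A = (\<Sum>\<^sub>\<infinity>c. diag A c)"

definition trace_pos :: "'a op \<Rightarrow> bool" where
  "trace_pos A \<longleftrightarrow> positive A \<and> diag A summable_on UNIV"

lemma positive_iff:
  "positive A \<longleftrightarrow> clinear_op A \<and> (\<forall>\<psi>. 0 \<le> quad A \<psi> \<and> Im (cinner \<psi> (blinfun_apply A \<psi>)) = 0)"
  by (simp add: positive_def complex_nonneg_Reals_iff Re_cinner)

lemma positive_clinear: "positive A \<Longrightarrow> clinear_op A"
  and quad_nonneg: "positive A \<Longrightarrow> 0 \<le> quad A \<psi>"
  by (simp_all add: positive_iff)

lemma cinner_quad: "positive A \<Longrightarrow> cinner \<psi> (blinfun_apply A \<psi>) = of_real (quad A \<psi>)"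
  by (simp add: complex_eq_iff positive_iff Re_cinner)

text \<open>Polarization: reality of the form at \<open>\<phi> + \<psi>\<close> fixes the imaginary
  parts, reality at \<open>\<phi> + scaleC \<i> \<psi>\<close> the real parts.\<close>

lemma positive_hermitian:
  assumes "positive A"
  shows "cinner \<psi> (blinfun_apply A \<phi>) = cnj (cinner \<phi> (blinfun_apply A \<psi>))"
proof -
  have Im0: "Im (cinner \<xi> (blinfun_apply A \<xi>)) = 0" for \<xi>
    using assms by (simp add: positive_iff)
  have "Im (cinner \<phi> (blinfun_apply A \<psi>)) + Im (cinner \<psi> (blinfun_apply A \<phi>)) = 0"
    using Im0[of "\<phi> + \<psi>"] Im0[of \<phi>] Im0[of \<psi>] by (simp add: blinfun.add_right cinner_simps)
  moreover have "Re (cinner \<phi> (blinfun_apply A \<psi>)) = Re (cinner \<psi> (blinfun_apply A \<phi>))"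
    using Im0[of "\<phi> + scaleC \<i> \<psi>"] Im0[of \<phi>] Im0[of \<psi>]
    by (simp add: blinfun.add_right cinner_simps cinner_scaleC_left
        clinear_opD[OF positive_clinear[OF assms]])
  ultimately show ?thesis
    by (simp add: complex_eq_iff)
qed

lemma positive_Cauchy_Schwarz:
  assumes "positive A"
  shows "(cmod (cinner \<phi> (blinfun_apply A \<psi>)))\<^sup>2 \<le> quad A \<phi> * quad A \<psi>"
proof -
  define b where "b = cinner \<phi> (blinfun_apply A \<psi>)"
  have ineq: "0 \<le> quad A \<phi> - 2 * s * (cmod b)\<^sup>2 + s\<^sup>2 * (cmod b)\<^sup>2 * quad A \<psi>" for s
  proof -
    \<comment> \<open>With this \<open>z\<close> both cross terms equal
      \<open>- s * (cmod b)\<^sup>2\<close>, which leaves a real quadratic polynomial in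
      \<open>s\<close>.\<close>
    define z where "z = - of_real s * cnj b"
    have "of_real (quad A (\<phi> + scaleC z \<psi>)) = cinner (\<phi> + scaleC z \<psi>) (blinfun_apply A (\<phi> + scaleC z \<psi>))"
      by (rule cinner_quad[OF assms, symmetric])
    also have "\<dots> = of_real (quad A \<phi>) + z * b + cnj z * cnj b + cnj z * z * of_real (quad A \<psi>)"
      using cinner_quad[OF assms, of \<phi>] cinner_quad[OF assms, of \<psi>] positive_hermitian[OF assms, of \<psi> \<phi>]
      by (simp add: blinfun.add_right cinner_simps cinner_scaleC_left
          clinear_opD[OF positive_clinear[OF assms]] b_def algebra_simps)
    also have "\<dots> = of_real (quad A \<phi>) - 2 * of_real s * (b * cnj b)
        + of_real (s\<^sup>2) * (b * cnj b) * of_real (quad A \<psi>)"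
      by (simp add: z_def power2_eq_square algebra_simps)
    also have "\<dots> = of_real (quad A \<phi> - 2 * s * (cmod b)\<^sup>2 + s\<^sup>2 * (cmod b)\<^sup>2 * quad A \<psi>)"
      unfolding complex_norm_square[symmetric] by simp
    finally show ?thesis
      using quad_nonneg[OF assms, of "\<phi> + scaleC z \<psi>"] by (simp only: of_real_eq_iff)
  qed
  have "(cmod b)\<^sup>2 \<le> quad A \<phi> * quad A \<psi>"
  proof (cases "quad A \<psi> = 0")
    case True
    have "b = 0"
    proof (rule ccontr)
      assume "b \<noteq> 0"
      \<comment> \<open>The polynomial is now linear in \<open>s\<close>, and at this
        \<open>s\<close> its value is -1.\<close>
      then show False
        using ineq[of "(quad A \<phi> + 1) / (2 * (cmod b)\<^sup>2)"] True by (simp add: field_simps)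
    qed
    then show ?thesis using True by simp
  next
    case False
    then have "quad A \<psi> > 0"
      using quad_nonneg[OF assms, of \<psi>] by simp
    \<comment> \<open>The polynomial is minimal at \<open>1 / quad A \<psi>\<close>.\<close>
    then show ?thesis
      using ineq[of "1 / quad A \<psi>"] by (simp add: field_simps power2_eq_square)
  qed
  then show ?thesis by (simp add: b_def)
qed

lemma positive_apply_eq_0:
  assumes "positive A" "quad A \<psi> = 0"
  shows "blinfun_apply A \<psi> = 0"
  by (rule coeff_eqI)
    (use positive_Cauchy_Schwarz[OF assms(1), of "ket _" \<psi>] assms(2) in simp)

lemma clinear_op_0 [simp]: "clinear_op 0"
  by (auto simp: clinear_op_def intro!: coeff_eqI)

lemma clinear_op_add: "clinear_op A \<Longrightarrow> clinear_op B \<Longrightarrow> clinear_op (A + B)"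
  and clinear_op_diff: "clinear_op A \<Longrightarrow> clinear_op B \<Longrightarrow> clinear_op (A - B)"
  by (auto simp: clinear_op_def blinfun.add_left blinfun.diff_left distrib_left right_diff_distrib
      intro!: coeff_eqI)

lemma clinear_op_compose: "clinear_op A \<Longrightarrow> clinear_op B \<Longrightarrow> clinear_op (A o\<^sub>L B)"
  by (simp add: clinear_op_def)

lemma bounded_linear_scaleC: "bounded_linear (scaleC z)"
  by (rule bounded_linear_intro[where K = "cmod z"])
    (auto simp: norm_scaleC distrib_left intro!: coeff_eqI)

lemma clinear_op_has_sum:
  assumes "(f has_sum s) J" "\<And>j. j \<in> J \<Longrightarrow> clinear_op (f j)"
  shows "clinear_op s"
  unfolding clinear_op_def
proof (intro allI)
  fix z \<psi>
  have "((\<lambda>j. blinfun_apply (f j) (scaleC z \<psi>)) has_sum blinfun_apply s (scaleC z \<psi>)) J"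
    by (rule has_sum_bounded_linear[OF blinfun.bounded_linear_left assms(1), unfolded o_def])
  moreover have "((\<lambda>j. scaleC z (blinfun_apply (f j) \<psi>)) has_sum scaleC z (blinfun_apply s \<psi>)) J"
    by (rule has_sum_bounded_linear[OF bounded_linear_compose[OF bounded_linear_scaleC
            blinfun.bounded_linear_left] assms(1), unfolded o_def])
  moreover have "((\<lambda>j. blinfun_apply (f j) (scaleC z \<psi>)) has_sum x) J
      \<longleftrightarrow> ((\<lambda>j. scaleC z (blinfun_apply (f j) \<psi>)) has_sum x) J" for x
    by (rule has_sum_cong) (simp add: clinear_opD assms(2))
  ultimately show "blinfun_apply s (scaleC z \<psi>) = scaleC z (blinfun_apply s \<psi>)"
    using has_sum_unique by blast
qed

lemma bounded_linear_cinner_op: "bounded_linear (\<lambda>A. cinner \<psi> (blinfun_apply A \<phi>))"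
  by (rule bounded_linear_compose[OF bounded_linear_cinner_right blinfun.bounded_linear_left])

lemma bounded_linear_quad: "bounded_linear (\<lambda>A. quad A \<psi>)"
  by (rule bounded_linear_compose[OF bounded_linear_inner_right blinfun.bounded_linear_left])

lemma quad_has_sum: "(f has_sum s) J \<Longrightarrow> ((\<lambda>j. quad (f j) \<psi>) has_sum quad s \<psi>) J"
  using has_sum_bounded_linear[OF bounded_linear_quad] by (auto simp: o_def)

lemma positive_0 [simp]: "positive 0"
  by (simp add: positive_iff cinner_simps)

lemma positive_add: "positive A \<Longrightarrow> positive B \<Longrightarrow> positive (A + B)"
  by (simp add: positive_iff clinear_op_add blinfun.add_left inner_add_right cinner_simps)

lemma positive_sum: "(\<And>j. j \<in> J \<Longrightarrow> positive (f j)) \<Longrightarrow> positive (sum f J)"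
  by (induction J rule: infinite_finite_induct) (auto intro: positive_add)

lemma positive_has_sum:
  assumes "(f has_sum s) J" "\<And>j. j \<in> J \<Longrightarrow> positive (f j)"
  shows "positive s"
  unfolding positive_iff
proof (intro conjI allI)
  show "clinear_op s"
    by (rule clinear_op_has_sum[OF assms(1)]) (simp add: positive_clinear assms(2))
  fix \<psi>
  show "0 \<le> quad s \<psi>"
    by (rule has_sum_nonneg[OF quad_has_sum[OF assms(1)]]) (simp add: quad_nonneg assms(2))
  have "((\<lambda>j. Im (cinner \<psi> (blinfun_apply (f j) \<psi>))) has_sum Im (cinner \<psi> (blinfun_apply s \<psi>))) J"
    by (rule has_sum_bounded_linear[OF bounded_linear_compose[OF bounded_linear_Im
            bounded_linear_cinner_op] assms(1), unfolded o_def])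
  moreover have "((\<lambda>j. Im (cinner \<psi> (blinfun_apply (f j) \<psi>))) has_sum 0) J"
    by (rule has_sum_0) (use assms(2) in \<open>simp add: positive_iff\<close>)
  ultimately show "Im (cinner \<psi> (blinfun_apply s \<psi>)) = 0"
    by (rule has_sum_unique)
qed

lemma has_sum_minus_partial:
  fixes f :: "'i \<Rightarrow> 'b::{topological_ab_group_add, t2_space}"
  assumes "(f has_sum s) J" "finite N" "N \<subseteq> J"
  shows "(f has_sum (s - sum f N)) (J - N)"
  using has_sum_Diff[OF assms(1) has_sum_finite[OF assms(2)] assms(3)] by simp

lemma has_sum_sum:
  fixes f :: "'i \<Rightarrow> 'j \<Rightarrow> 'b::topological_comm_monoid_add"
  assumes "\<And>j. j \<in> J \<Longrightarrow> (f j has_sum s j) A"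
  shows "((\<lambda>x. \<Sum>j\<in>J. f j x) has_sum (\<Sum>j\<in>J. s j)) A"
  using assms by (induction J rule: infinite_finite_induct) (auto intro: has_sum_add)

text \<open>Antisymmetry of the Loewner order, in the form that later makes least upper bounds
  unique.\<close>

lemma positive_antisym:
  assumes "positive A" "positive (- A)"
  shows "A = 0"
proof (rule blinfun_eqI)
  fix \<psi>
  have "quad A \<psi> = 0"
    using quad_nonneg[OF assms(1), of \<psi>] quad_nonneg[OF assms(2), of \<psi>]
    by (simp add: blinfun.minus_left)
  then show "blinfun_apply A \<psi> = blinfun_apply 0 \<psi>"
    by (simp add: positive_apply_eq_0[OF assms(1)])
qed

section \<open>Traces of positive operators and of their sums\<close>

lemma diag_nonneg: "positive A \<Longrightarrow> 0 \<le> diag A c"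
  by (simp add: diag_def quad_nonneg)

lemma trace_nonneg: "positive A \<Longrightarrow> 0 \<le> trace A"
  unfolding trace_def by (rule infsum_nonneg) (rule diag_nonneg)

lemma trace_posD: "trace_pos A \<Longrightarrow> positive A"
  by (simp add: trace_pos_def)

lemma trace_has_sum: "trace_pos A \<Longrightarrow> (diag A has_sum trace A) UNIV"
  by (simp add: trace_pos_def trace_def)

lemma sum_diag_le_trace: "trace_pos A \<Longrightarrow> finite F \<Longrightarrow> (\<Sum>c\<in>F. diag A c) \<le> trace A"
  by (rule finite_sum_le_has_sum[OF trace_has_sum]) (auto simp: trace_posD diag_nonneg)

lemma trace_posI_bound:
  assumes "positive A" "\<And>F. finite F \<Longrightarrow> (\<Sum>c\<in>F. diag A c) \<le> K"
  shows "trace_pos A" "trace A \<le> K"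
proof -
  show *: "trace_pos A"
    unfolding trace_pos_def
    using assms by (auto intro!: nonneg_bdd_above_summable_on bdd_aboveI2[where M = K] simp: diag_nonneg)
  show "trace A \<le> K"
    by (rule has_sum_le_finite_sums[OF trace_has_sum[OF *]]) (simp add: assms)
qed

lemma diag_add: "diag (A + B) c = diag A c + diag B c"
  by (simp add: diag_def blinfun.add_left inner_add_right)

lemma trace_pos_0 [simp]: "trace_pos 0" and trace_0 [simp]: "trace 0 = 0"
proof -
  have [simp]: "diag 0 = (\<lambda>_. 0)"
    by (simp add: fun_eq_iff diag_def)
  show "trace_pos 0" "trace 0 = 0"
    by (simp_all add: trace_pos_def trace_def)
qed

lemma trace_pos_add:
  assumes "trace_pos A" "trace_pos B"
  shows "trace_pos (A + B)" "trace (A + B) = trace A + trace B"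
proof -
  have "(diag (A + B) has_sum (trace A + trace B)) UNIV"
    using has_sum_add[OF assms[THEN trace_has_sum]] by (simp add: diag_add[abs_def])
  then show "trace_pos (A + B)" "trace (A + B) = trace A + trace B"
    using assms by (auto simp: trace_pos_def positive_add trace_def infsumI has_sum_imp_summable)
qed

lemma trace_pos_sum:
  assumes "\<And>j. j \<in> J \<Longrightarrow> trace_pos (f j)"
  shows "trace_pos (sum f J) \<and> trace (sum f J) = (\<Sum>j\<in>J. trace (f j))"
  using assms by (induction J rule: infinite_finite_induct) (auto simp: trace_pos_add)

lemma trace_pos_mono:
  assumes "trace_pos B" "positive A" "positive (B - A)"
  shows "trace_pos A" "trace A \<le> trace B"
proof -
  have "diag A c \<le> diag B c" for c
    using diag_nonneg[OF assms(3), of c] by (simp add: diag_def blinfun.diff_left inner_diff_right)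
  then have "(\<Sum>c\<in>F. diag A c) \<le> trace B" if "finite F" for F
    using sum_mono[of F "diag A" "diag B"] sum_diag_le_trace[OF assms(1) that] by force
  then show "trace_pos A" "trace A \<le> trace B"
    using trace_posI_bound[OF assms(2)] by blast+
qed

text \<open>Cauchy-Schwarz for the form of \<open>A\<close> bounds the squared modulus of coordinate
  \<open>c\<close> of \<open>A \<psi>\<close> by \<open>diag A c * quad A \<psi>\<close>. Summation
  over \<open>c\<close> brings in the trace, and one factor \<open>norm (A \<psi>)\<close>
  cancels.\<close>

lemma norm_le_trace:
  assumes "trace_pos A"
  shows "norm A \<le> trace A"
proof (rule norm_blinfun_bound)
  show "0 \<le> trace A"
    by (simp add: trace_nonneg trace_posD assms)
  fix \<psi>
  let ?x = "blinfun_apply A \<psi>"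
  have pos: "positive A"
    by (simp add: trace_posD assms)
  have "(norm ?x)\<^sup>2 \<le> trace A * quad A \<psi>"
  proof (rule has_sum_le_finite_sums[OF has_sum_norm_ell2])
    fix F :: "'a set"
    assume "finite F"
    have "(\<Sum>c\<in>F. (cmod (coeff ?x c))\<^sup>2) \<le> (\<Sum>c\<in>F. diag A c * quad A \<psi>)"
      using positive_Cauchy_Schwarz[OF pos, of "ket _" \<psi>] by (intro sum_mono) (simp add: diag_def)
    also have "\<dots> \<le> trace A * quad A \<psi>"
      unfolding sum_distrib_right[symmetric]
      by (intro mult_right_mono sum_diag_le_trace assms \<open>finite F\<close> quad_nonneg pos)
    finally show "(\<Sum>c\<in>F. (cmod (coeff ?x c))\<^sup>2) \<le> trace A * quad A \<psi>" .
  qed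
  also have "\<dots> \<le> trace A * (norm \<psi> * norm ?x)"
    by (intro mult_left_mono norm_cauchy_schwarz) fact
  finally have "norm ?x * norm ?x \<le> (trace A * norm \<psi>) * norm ?x"
    by (simp add: power2_eq_square algebra_simps)
  then show "norm ?x \<le> trace A * norm \<psi>"
    using \<open>0 \<le> trace A\<close> by (cases "norm ?x = 0") auto
qed

text \<open>The norms are dominated by the traces, hence convergence. The value of the trace is
  Fubini for the nonnegative array \<open>diag (f j) c\<close>, summed over \<open>c\<close> first
  and then over \<open>j\<close>.\<close>

lemma trace_summable_imp_has_sum:
  fixes f :: "'i \<Rightarrow> 'a op"
  assumes "\<And>j. j \<in> J \<Longrightarrow> trace_pos (f j)" "((\<lambda>j. trace (f j)) has_sum t) J"
  shows "f summable_on J" "trace_pos (infsum f J)" "trace (infsum f J) = t"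
proof -
  show summable: "f summable_on J"
  proof (rule abs_summable_summable, rule summable_on_comparison_test)
    show "(\<lambda>j. trace (f j)) summable_on J"
      using assms(2) by (rule has_sum_imp_summable)
  qed (use assms norm_le_trace in auto)
  let ?s = "infsum f J"
  have pos: "positive ?s"
    by (rule positive_has_sum[OF has_sum_infsum[OF summable]]) (simp add: assms trace_posD)
  have diag: "((\<lambda>j. diag (f j) c) has_sum diag ?s c) J" for c
    unfolding diag_def by (rule quad_has_sum[OF has_sum_infsum[OF summable]])
  have "(\<lambda>(j, c). diag (f j) c) summable_on (J \<times> UNIV)"
    by (rule summable_on_SigmaI)
      (use assms trace_has_sum in \<open>auto intro: has_sum_imp_summable diag_nonneg trace_posD\<close>)
  then have "((\<lambda>(j, c). diag (f j) c) has_sum t) (J \<times> UNIV)"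
    by (intro has_sum_SigmaI[OF _ assms(2)]) (auto simp: assms trace_has_sum)
  then have "((\<lambda>(c, j). diag (f j) c) has_sum t) (UNIV \<times> J)"
    using has_sum_swap by fastforce
  then have "(diag ?s has_sum t) UNIV"
    by (rule has_sum_SigmaD) (simp add: diag)
  then show "trace_pos ?s" "trace ?s = t"
    by (auto simp: trace_pos_def pos trace_def infsumI has_sum_imp_summable)
qed

text \<open>The converse direction: finite partial sums lie below \<open>s\<close>, so their traces
  are bounded by \<open>trace s\<close> and the series of traces converges; the preceding lemma
  identifies its limit.\<close>

lemma has_sum_imp_trace_has_sum:
  assumes "\<And>j. j \<in> J \<Longrightarrow> trace_pos (f j)" "(f has_sum s) J" "trace_pos s"
  shows "((\<lambda>j. trace (f j)) has_sum trace s) J"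
proof -
  have "(\<Sum>j\<in>N. trace (f j)) \<le> trace s" if N: "finite N" "N \<subseteq> J" for N
  proof -
    have "positive (s - sum f N)"
      by (rule positive_has_sum[OF has_sum_minus_partial[OF assms(2) N]])
        (use assms(1) in \<open>auto intro: trace_posD\<close>)
    moreover have "positive (sum f N)"
      by (rule positive_sum) (use assms(1) N in \<open>auto intro: trace_posD\<close>)
    ultimately have "trace (sum f N) \<le> trace s"
      by (intro trace_pos_mono(2)[OF assms(3)])
    moreover have "trace (sum f N) = (\<Sum>j\<in>N. trace (f j))"
      using trace_pos_sum[of N f] assms(1) N by blast
    ultimately show ?thesis by simp
  qed
  then have "(\<lambda>j. trace (f j)) summable_on J"
    by (intro nonneg_bdd_above_summable_on bdd_aboveI2[where M = "trace s"])
      (auto intro!: trace_nonneg trace_posD assms(1))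
  then have "((\<lambda>j. trace (f j)) has_sum (\<Sum>\<^sub>\<infinity>j\<in>J. trace (f j))) J"
    by simp
  moreover from this have "trace (infsum f J) = (\<Sum>\<^sub>\<infinity>j\<in>J. trace (f j))"
    using trace_summable_imp_has_sum(3)[of J f] assms(1) by blast
  moreover have "infsum f J = s"
    using assms(2) by (rule infsumI)
  ultimately show ?thesis by simp
qed

text \<open>An iterated sum becomes a sum over pairs once the family is summable over all pairs.
  This is checked on the traces, where nonnegativity lets it follow from the iterated sum.\<close>

lemma trace_has_sum_SigmaI:
  assumes "\<And>j k. j \<in> J \<Longrightarrow> k \<in> K j \<Longrightarrow> trace_pos (f (j, k))"
    and "\<And>j. j \<in> J \<Longrightarrow> trace_pos (g j)" "trace_pos s"
    and "\<And>j. j \<in> J \<Longrightarrow> ((\<lambda>k. f (j, k)) has_sum g j) (K j)" "(g has_sum s) J"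
  shows "(f has_sum s) (Sigma J K)"
proof (rule has_sum_SigmaI[OF assms(4,5)])
  have "(\<lambda>p. trace (f p)) summable_on Sigma J K"
  proof (rule summable_on_SigmaI)
    show "((\<lambda>k. trace (f (j, k))) has_sum trace (g j)) (K j)" if "j \<in> J" for j
      by (rule has_sum_imp_trace_has_sum) (use assms that in auto)
    have "((\<lambda>j. trace (g j)) has_sum trace s) J"
      by (rule has_sum_imp_trace_has_sum) (use assms in auto)
    then show "(\<lambda>j. trace (g j)) summable_on J"
      by (rule has_sum_imp_summable)
  qed (use assms in \<open>auto intro: trace_nonneg trace_posD\<close>)
  then have "((\<lambda>p. trace (f p)) has_sum (\<Sum>\<^sub>\<infinity>p\<in>Sigma J K. trace (f p))) (Sigma J K)"
    by (rule has_sum_infsum)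
  then show "f summable_on Sigma J K"
    by (rule trace_summable_imp_has_sum(1)[rotated]) (use assms in auto)
qed auto

section \<open>Kraus families do not increase the trace\<close>

definition rank_one :: "'a ell2 \<Rightarrow> 'a op" where
  "rank_one v = Blinfun (\<lambda>\<psi>. scaleC (cinner v \<psi>) v)"

lemma rank_one_apply: "blinfun_apply (rank_one v) = (\<lambda>\<psi>. scaleC (cinner v \<psi>) v)"
  and clinear_rank_one: "clinear_op (rank_one v)"
proof -
  have "norm (scaleC (cinner v \<psi>) v) \<le> norm \<psi> * (norm v * norm v)" for \<psi>
    using mult_right_mono[OF cinner_bound[of v \<psi>], of "norm v"]
    by (simp add: norm_scaleC algebra_simps)
  note * = bounded_clinearI[where A = "\<lambda>\<psi>. scaleC (cinner v \<psi>) v", OF _ _ this]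
  show "blinfun_apply (rank_one v) = (\<lambda>\<psi>. scaleC (cinner v \<psi>) v)"
    unfolding rank_one_def by (rule *(3)) (auto simp: cinner_simps algebra_simps intro!: coeff_eqI)
  show "clinear_op (rank_one v)"
    unfolding rank_one_def by (rule *(2)) (auto simp: cinner_simps algebra_simps intro!: coeff_eqI)
qed

lemma cinner_rank_one: "cinner \<psi> (blinfun_apply (rank_one v) \<psi>) = of_real ((cmod (cinner v \<psi>))\<^sup>2)"
  using cinner_cnj[of v \<psi>] unfolding complex_norm_square
  by (simp add: rank_one_apply cinner_simps)

lemma quad_rank_one: "quad (rank_one v) \<psi> = (cmod (cinner v \<psi>))\<^sup>2"
  using cinner_rank_one[of \<psi> v] by (simp add: Re_cinner[symmetric] del: of_real_power)

(* Cholesky decomposition: each pivot removes one basis vector from the support of the remainder. *)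
lemma cholesky:
  assumes "finite F" "positive \<rho>"
  shows "\<exists>v R. positive R \<and> (\<forall>c\<in>F. blinfun_apply R (ket c) = 0)
    \<and> (\<forall>\<psi>. quad \<rho> \<psi> = (\<Sum>k\<in>F. (cmod (cinner (v k) \<psi>))\<^sup>2) + quad R \<psi>)"
  using assms(1)
proof induction
  case empty
  then show ?case using assms(2) by auto
next
  case (insert e F)
  then obtain v R where R: "positive R" "\<forall>c\<in>F. blinfun_apply R (ket c) = 0"
    and dec: "\<And>\<psi>. quad \<rho> \<psi> = (\<Sum>k\<in>F. (cmod (cinner (v k) \<psi>))\<^sup>2) + quad R \<psi>"
    by auto
  define w where "w = blinfun_apply R (ket e)"
  define a where "a = quad R (ket e)"
  \<comment> \<open>One Cholesky step: subtracting \<open>rank_one u\<close> leaves the Schur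
    complement of the pivot \<open>a\<close>. If \<open>a = 0\<close>, then
    \<open>1 / sqrt a\<close> is 0 by the convention for division and nothing is subtracted, which
    is right because \<open>w = 0\<close> in that case.\<close>
  define u where "u = scaleC (of_real (1 / sqrt a)) w"
  define R' where "R' = R - rank_one u"
  have "a \<ge> 0"
    using R by (simp add: a_def quad_nonneg)
  have a: "cinner (ket e) w = of_real a"
    using cinner_quad[OF R(1), of "ket e"] by (simp only: w_def a_def)
  have w0: "w = 0" if "a = 0"
    using positive_apply_eq_0[OF R(1)] that by (simp add: w_def a_def)
  have w_swap: "cinner w \<psi> = cinner (ket e) (blinfun_apply R \<psi>)" for \<psi>
    using positive_hermitian[OF R(1), of "ket e" \<psi>] cinner_cnj[of \<psi> w] by (simp only: w_def)
  have u: "cinner u \<psi> = of_real (1 / sqrt a) * cinner (ket e) (blinfun_apply R \<psi>)" for \<psi>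
    by (simp only: u_def cinner_scaleC_left w_swap complex_cnj_complex_of_real)
  have quad_R': "quad R' \<psi> = quad R \<psi> - (cmod (cinner u \<psi>))\<^sup>2" for \<psi>
    by (simp add: R'_def blinfun.diff_left inner_diff_right quad_rank_one)
  have "positive R'"
    unfolding positive_iff
  proof (intro conjI allI)
    show "clinear_op R'"
      by (simp add: R'_def clinear_op_diff clinear_rank_one positive_clinear R)
    fix \<psi>
    show "Im (cinner \<psi> (blinfun_apply R' \<psi>)) = 0"
      using R by (simp add: R'_def blinfun.diff_left cinner_simps cinner_rank_one positive_iff)
    \<comment> \<open>The remainder stays positive by Cauchy-Schwarz for the form of
      \<open>R\<close>, applied to \<open>ket e\<close> and \<open>\<psi>\<close>.\<close>
    have "(cmod (cinner u \<psi>))\<^sup>2 \<le> quad R \<psi>"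
    proof (cases "a = 0")
      case False
      then have "(cmod (cinner u \<psi>))\<^sup>2 = (cmod (cinner (ket e) (blinfun_apply R \<psi>)))\<^sup>2 / a"
        using \<open>a \<ge> 0\<close> by (simp add: u norm_mult norm_divide power_mult_distrib power_divide)
      also have "\<dots> \<le> quad R \<psi>"
        using positive_Cauchy_Schwarz[OF R(1), of "ket e" \<psi>] False \<open>a \<ge> 0\<close>
        by (simp add: a_def field_simps)
      finally show ?thesis .
    qed (simp add: u quad_nonneg R)
    then show "0 \<le> quad R' \<psi>"
      by (simp add: quad_R')
  qed
  moreover have "blinfun_apply R' (ket c) = 0" if "c \<in> insert e F" for c
  proof (cases "c \<in> F")
    case True
    \<comment> \<open>Earlier pivots stay eliminated: \<open>R (ket c) = 0\<close> also makes
      \<open>cinner u (ket c)\<close> vanish.\<close>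
    then show ?thesis
      using R by (auto simp: R'_def blinfun.diff_left rank_one_apply u cinner_simps intro!: coeff_eqI)
  next
    case False
    with that have [simp]: "c = e" by simp
    show ?thesis
    proof (cases "a = 0")
      case True
      then show ?thesis
        using w0 by (auto simp: R'_def blinfun.diff_left rank_one_apply u_def w_def[symmetric]
            intro!: coeff_eqI)
    next
      case False
      have "cinner u (ket e) * of_real (1 / sqrt a) = 1"
        using False \<open>a \<ge> 0\<close>
        by (simp only: u w_def[symmetric] a of_real_mult[symmetric])
          (simp add: divide_simps del: of_real_mult of_real_divide flip: of_real_mult of_real_divide)
      then show ?thesis
        by (auto simp: R'_def blinfun.diff_left rank_one_apply w_def[symmetric] intro!: coeff_eqI)
          (simp add: u_def mult.assoc[symmetric])
    qed
  qed
  moreover have "quad \<rho> \<psi> = (\<Sum>k\<in>insert e F. (cmod (cinner ((v(e := u)) k) \<psi>))\<^sup>2) + quad R' \<psi>" for \<psi>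
  proof -
    have "(\<Sum>k\<in>F. (cmod (cinner ((v(e := u)) k) \<psi>))\<^sup>2) = (\<Sum>k\<in>F. (cmod (cinner (v k) \<psi>))\<^sup>2)"
      by (rule sum.cong) (use insert in auto)
    then show ?thesis
      using insert by (simp add: dec quad_R')
  qed
  ultimately show ?case by blast
qed

lemma quad_sandwich_adj:
  assumes "clinear_op B"
  shows "quad (sandwich B (adj B) \<rho>) \<psi> = quad \<rho> (blinfun_apply (adj B) \<psi>)"
  by (simp add: sandwich_def Re_cinner[symmetric] cinner_adj_left[OF assms])

lemma positive_sandwich_adj:
  assumes "clinear_op B" "positive \<rho>"
  shows "positive (sandwich B (adj B) \<rho>)"
proof -
  have "clinear_op (sandwich B (adj B) \<rho>)"
    using assms by (simp add: sandwich_def clinear_op_compose clinear_adj positive_clinear)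
  moreover have "cinner \<psi> (blinfun_apply (sandwich B (adj B) \<rho>) \<psi>)
      = cinner (blinfun_apply (adj B) \<psi>) (blinfun_apply \<rho> (blinfun_apply (adj B) \<psi>))" for \<psi>
    by (simp add: sandwich_def cinner_adj_left[OF assms(1)])
  ultimately show ?thesis
    using assms(2) by (simp add: positive_def)
qed

(* The Cholesky remainder R has trace at most e, and the finitely many diagonal entries of the
   sum see at most a constant multiple of it. *)
lemma kraus_diag_sum_le:
  assumes "finite N" "finite G" "trace_pos \<rho>" "\<And>m. m \<in> N \<Longrightarrow> clinear_op (B m)"
    and contr: "\<And>\<psi>. (\<Sum>m\<in>N. (norm (blinfun_apply (B m) \<psi>))\<^sup>2) \<le> (norm \<psi>)\<^sup>2"
  shows "(\<Sum>m\<in>N. \<Sum>c\<in>G. diag (sandwich (B m) (adj (B m)) \<rho>) c) \<le> trace \<rho>"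
proof -
  define \<xi> where "\<xi> m c = blinfun_apply (adj (B m)) (ket c)" for m c
  \<comment> \<open>The form of \<open>R\<close> at \<open>\<xi> m c\<close> is at most
    \<open>norm R\<close> times the squared norm of \<open>\<xi> m c\<close>. Their total
    \<open>K\<close> does not depend on \<open>\<epsilon>\<close>, so its size is harmless.\<close>
  define K where "K = (\<Sum>m\<in>N. \<Sum>c\<in>G. (norm (\<xi> m c))\<^sup>2)"
  have "K \<ge> 0"
    by (simp add: K_def sum_nonneg)
  have *: "(\<Sum>m\<in>N. \<Sum>c\<in>G. diag (sandwich (B m) (adj (B m)) \<rho>) c) \<le> trace \<rho> + \<epsilon> * K" if "\<epsilon> > 0" for \<epsilon>
  proof -
    \<comment> \<open>\<open>F\<close> carries all but \<open>\<epsilon>\<close> of the trace. The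
      remainder after elimination has a diagonal that vanishes on \<open>F\<close> and lies below
      that of \<open>\<rho>\<close> elsewhere.\<close>
    obtain F where F: "finite F" "dist (\<Sum>c\<in>F. diag \<rho> c) (trace \<rho>) \<le> \<epsilon>"
      using has_sum_finite_approximation[OF trace_has_sum[OF assms(3)] \<open>\<epsilon> > 0\<close>] by blast
    obtain v R where R: "positive R" "\<And>c. c \<in> F \<Longrightarrow> blinfun_apply R (ket c) = 0"
      and dec: "\<And>\<psi>. quad \<rho> \<psi> = (\<Sum>k\<in>F. (cmod (cinner (v k) \<psi>))\<^sup>2) + quad R \<psi>"
      using cholesky[OF F(1) trace_posD[OF assms(3)]] by blast
    have diag_R: "diag \<rho> c = (\<Sum>k\<in>F. (cmod (coeff (v k) c))\<^sup>2) + diag R c" for c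
      by (simp add: diag_def dec)
    have R_le: "diag R c \<le> diag \<rho> c" for c
      unfolding diag_R by (simp add: sum_nonneg)
    have "diag R summable_on UNIV"
      by (rule summable_on_comparison_test[of "diag \<rho>"])
        (use assms(3) R_le in \<open>auto simp: trace_pos_def diag_nonneg R\<close>)
    then have R_tp: "trace_pos R"
      using R by (simp add: trace_pos_def)
    have "trace R \<le> \<epsilon>"
    proof -
      have "(diag R has_sum trace R) (UNIV - F)"
        using has_sum_minus_partial[OF trace_has_sum[OF R_tp] F(1)] R(2) by (simp add: diag_def)
      moreover have "(diag \<rho> has_sum (trace \<rho> - (\<Sum>c\<in>F. diag \<rho> c))) (UNIV - F)"
        using has_sum_minus_partial[OF trace_has_sum[OF assms(3)] F(1)] by simp
      ultimately have "trace R \<le> trace \<rho> - (\<Sum>c\<in>F. diag \<rho> c)"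
        by (rule has_sum_mono) (rule R_le)
      then show ?thesis using F(2) by (simp add: dist_real_def)
    qed
    have "((\<lambda>c. (\<Sum>k\<in>F. (cmod (coeff (v k) c))\<^sup>2) + diag R c) has_sum
        ((\<Sum>k\<in>F. (norm (v k))\<^sup>2) + trace R)) UNIV"
      by (intro has_sum_add has_sum_sum has_sum_norm_ell2 trace_has_sum R_tp)
    then have "(diag \<rho> has_sum ((\<Sum>k\<in>F. (norm (v k))\<^sup>2) + trace R)) UNIV"
      by (simp add: diag_R[abs_def])
    then have "trace \<rho> = (\<Sum>k\<in>F. (norm (v k))\<^sup>2) + trace R"
      using trace_has_sum[OF assms(3)] has_sum_unique by blast
    then have v_le: "(\<Sum>k\<in>F. (norm (v k))\<^sup>2) \<le> trace \<rho>"
      using trace_nonneg[OF R(1)] by simp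
    \<comment> \<open>Moving the adjoint across, each rank one part contributes squared coordinates
      of \<open>B m (v k)\<close>. Summed over \<open>c\<close> they are bounded by squared norms,
      to which the contraction hypothesis applies.\<close>
    have "(\<Sum>m\<in>N. \<Sum>c\<in>G. diag (sandwich (B m) (adj (B m)) \<rho>) c)
        = (\<Sum>m\<in>N. \<Sum>c\<in>G. (\<Sum>k\<in>F. (cmod (coeff (blinfun_apply (B m) (v k)) c))\<^sup>2) + quad R (\<xi> m c))"
      by (intro sum.cong refl)
        (simp add: diag_def quad_sandwich_adj dec cinner_adj_right assms(4) \<xi>_def)
    also have "\<dots> \<le> (\<Sum>m\<in>N. (\<Sum>k\<in>F. (norm (blinfun_apply (B m) (v k)))\<^sup>2) + \<epsilon> * (\<Sum>c\<in>G. (norm (\<xi> m c))\<^sup>2))"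
    proof (intro sum_mono)
      fix m
      have "quad R x \<le> \<epsilon> * (norm x)\<^sup>2" for x
      proof -
        have "quad R x \<le> norm x * (norm R * norm x)"
          using norm_cauchy_schwarz[of x "blinfun_apply R x"] norm_blinfun[of R x]
            mult_left_mono[of _ _ "norm x"] by fastforce
        also have "\<dots> = norm R * (norm x)\<^sup>2"
          by (simp add: power2_eq_square)
        also have "\<dots> \<le> \<epsilon> * (norm x)\<^sup>2"
          using norm_le_trace[OF R_tp] \<open>trace R \<le> \<epsilon>\<close> by (intro mult_right_mono) auto
        finally show ?thesis .
      qed
      moreover have "(\<Sum>c\<in>G. \<Sum>k\<in>F. (cmod (coeff (blinfun_apply (B m) (v k)) c))\<^sup>2)
          \<le> (\<Sum>k\<in>F. (norm (blinfun_apply (B m) (v k)))\<^sup>2)"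
        by (subst sum.swap) (intro sum_mono sum_coeff_square_le assms)
      ultimately show "(\<Sum>c\<in>G. (\<Sum>k\<in>F. (cmod (coeff (blinfun_apply (B m) (v k)) c))\<^sup>2) + quad R (\<xi> m c))
          \<le> (\<Sum>k\<in>F. (norm (blinfun_apply (B m) (v k)))\<^sup>2) + \<epsilon> * (\<Sum>c\<in>G. (norm (\<xi> m c))\<^sup>2)"
        unfolding sum.distrib sum_distrib_left by (intro add_mono sum_mono) auto
    qed
    also have "\<dots> = (\<Sum>k\<in>F. \<Sum>m\<in>N. (norm (blinfun_apply (B m) (v k)))\<^sup>2) + \<epsilon> * K"
      unfolding sum.distrib K_def sum_distrib_left by (subst sum.swap) simp
    also have "\<dots> \<le> trace \<rho> + \<epsilon> * K"
      using sum_mono[of F "\<lambda>k. \<Sum>m\<in>N. (norm (blinfun_apply (B m) (v k)))\<^sup>2" "\<lambda>k. (norm (v k))\<^sup>2"]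
        contr v_le by simp
    finally show ?thesis .
  qed
  show ?thesis
  proof (rule field_le_epsilon)
    fix e :: real
    assume "e > 0"
    \<comment> \<open>The summand 1 keeps the chosen bound for \<open>\<epsilon>\<close> well
      defined when \<open>K = 0\<close>.\<close>
    have "e / (K + 1) * K \<le> e"
      using \<open>e > 0\<close> \<open>K \<ge> 0\<close> by (simp add: field_simps)
    then show "(\<Sum>m\<in>N. \<Sum>c\<in>G. diag (sandwich (B m) (adj (B m)) \<rho>) c) \<le> trace \<rho> + e"
      using *[of "e / (K + 1)"] \<open>e > 0\<close> \<open>K \<ge> 0\<close> by simp
  qed
qed

text \<open>The condition says that the sum of the operators \<open>adj (B j) o\<^sub>L B j\<close>
  is at most the identity. Stated on vectors and finite subfamilies it makes sense for infinite
  \<open>J\<close> without any operator series.\<close>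

definition kraus_family :: "'i set \<Rightarrow> ('i \<Rightarrow> 'a op) \<Rightarrow> bool" where
  "kraus_family J B \<longleftrightarrow> (\<forall>j\<in>J. clinear_op (B j)) \<and>
     (\<forall>N \<psi>. finite N \<longrightarrow> N \<subseteq> J \<longrightarrow> (\<Sum>j\<in>N. (norm (blinfun_apply (B j) \<psi>))\<^sup>2) \<le> (norm \<psi>)\<^sup>2)"

lemma
  assumes "kraus_family J B" "trace_pos \<rho>"
  shows trace_pos_kraus: "\<And>j. j \<in> J \<Longrightarrow> trace_pos (sandwich (B j) (adj (B j)) \<rho>)"
    and trace_kraus_sum_le: "\<And>N. finite N \<Longrightarrow> N \<subseteq> J \<Longrightarrow>
      (\<Sum>j\<in>N. trace (sandwich (B j) (adj (B j)) \<rho>)) \<le> trace \<rho>"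
proof -
  let ?K = "\<lambda>j. sandwich (B j) (adj (B j)) \<rho>"
  have *: "(\<Sum>j\<in>N. \<Sum>c\<in>G. diag (?K j) c) \<le> trace \<rho>" if "finite N" "N \<subseteq> J" "finite G" for N G
    using kraus_diag_sum_le[of N G \<rho> B] assms that unfolding kraus_family_def by blast
  show tp: "trace_pos (?K j)" if "j \<in> J" for j
    using *[of "{j}"] that assms
    by (intro trace_posI_bound[where K = "trace \<rho>"] positive_sandwich_adj)
      (auto simp: kraus_family_def trace_posD)
  show "(\<Sum>j\<in>N. trace (?K j)) \<le> trace \<rho>" if N: "finite N" "N \<subseteq> J" for N
  proof (rule has_sum_le_finite_sums)
    show "((\<lambda>c. \<Sum>j\<in>N. diag (?K j) c) has_sum (\<Sum>j\<in>N. trace (?K j))) UNIV"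
      by (intro has_sum_sum trace_has_sum tp) (use N in auto)
    show "(\<Sum>c\<in>G. \<Sum>j\<in>N. diag (?K j) c) \<le> trace \<rho>" if "finite G" for G
      by (subst sum.swap) (rule *[OF N that])
  qed
qed

section \<open>Extension of operators to further variables\<close>

text \<open>Identifies pairs of basis assignments on \<open>V - W\<close> and \<open>W\<close> with
  the basis of \<open>V\<close>. Outside \<open>W\<close> the value is that of \<open>r\<close>, so
  for \<open>r\<close> in \<open>qbasis (V - W)\<close> the result is \<open>undefined\<close>
  outside \<open>V\<close>, as \<open>PiE\<close> demands.\<close>

definition merge :: "'v qvar set \<Rightarrow> ('v qvar \<Rightarrow> int) \<Rightarrow> ('v qvar \<Rightarrow> int) \<Rightarrow> 'v qvar \<Rightarrow> int" where
  "merge W r w = (\<lambda>x. if x \<in> W then w x else r x)"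

lemma restrict_in_qbasis: "c \<in> qbasis V \<Longrightarrow> W \<subseteq> V \<Longrightarrow> restrict c W \<in> qbasis W"
  by (auto simp: qbasis_def PiE_iff)

lemma merge_restrict: "c \<in> qbasis V \<Longrightarrow> W \<subseteq> V \<Longrightarrow> merge W (restrict c (V - W)) (restrict c W) = c"
  by (auto simp: qbasis_def merge_def fun_eq_iff PiE_iff extensional_def)

lemma merge_in_qbasis:
  "r \<in> qbasis (V - W) \<Longrightarrow> w \<in> qbasis W \<Longrightarrow> W \<subseteq> V \<Longrightarrow> merge W r w \<in> qbasis V"
  by (auto simp: qbasis_def merge_def PiE_iff extensional_def)

lemma restrict_merge:
  assumes "r \<in> qbasis (V - W)" "w \<in> qbasis W" "W \<subseteq> V"
  shows "restrict (merge W r w) W = w" "restrict (merge W r w) (V - W) = r"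
  using assms by (auto simp: qbasis_def merge_def fun_eq_iff PiE_iff extensional_def)

lemma merge_eq_iff:
  assumes "r \<in> qbasis (V - W)" "w \<in> qbasis W" "W \<subseteq> V"
  shows "merge W r w = d \<longleftrightarrow> d \<in> qbasis V \<and> r = restrict d (V - W) \<and> w = restrict d W"
  using assms restrict_merge[OF assms] merge_in_qbasis[OF assms] merge_restrict[OF _ assms(3)] by auto

lemma bij_betw_merge:
  assumes "W \<subseteq> V"
  shows "bij_betw (\<lambda>(r, w). merge W r w) (qbasis (V - W) \<times> qbasis W) (qbasis V)"
  by (rule bij_betw_byWitness[where f' = "\<lambda>c. (restrict c (V - W), restrict c W)"])
    (use assms in \<open>auto simp: restrict_merge merge_restrict merge_in_qbasis restrict_in_qbasis\<close>)

lemma inj_on_merge: "inj_on (merge W r) (qbasis W)"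
proof (rule inj_onI)
  fix w w'
  assume w: "w \<in> qbasis W" "w' \<in> qbasis W" and eq: "merge W r w = merge W r w'"
  have "w x = w' x" for x
    using w fun_cong[OF eq, of x]
    by (cases "x \<in> W") (auto simp: qbasis_def merge_def PiE_iff extensional_def)
  then show "w = w'" by auto
qed

lemma has_sum_qbasis_split:
  fixes f :: "('v qvar \<Rightarrow> int) \<Rightarrow> 'b::topological_comm_monoid_add"
  assumes "W \<subseteq> V"
  shows "((\<lambda>(r, w). f (merge W r w)) has_sum s) (qbasis (V - W) \<times> qbasis W)
    \<longleftrightarrow> (f has_sum s) (qbasis V)"
  using has_sum_reindex_bij_betw[OF bij_betw_merge[OF assms], of f s]
  by (simp add: case_prod_unfold)

text \<open>The partial inner product with the basis state \<open>r\<close> of the remaining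
  variables; it leaves a vector on \<open>W\<close>.\<close>

lift_definition slice ::
  "'v qvar set \<Rightarrow> ('v qvar \<Rightarrow> int) \<Rightarrow> ('v qvar \<Rightarrow> int) ell2 \<Rightarrow> ('v qvar \<Rightarrow> int) ell2"
  is "\<lambda>W r f w. if w \<in> qbasis W then f (merge W r w) else 0"
proof -
  fix W r and f :: "('v qvar \<Rightarrow> int) \<Rightarrow> complex"
  assume "(\<lambda>x. (cmod (f x))\<^sup>2) summable_on UNIV"
  then have "(\<lambda>x. (cmod (f x))\<^sup>2) summable_on (merge W r ` qbasis W)"
    by (rule summable_on_subset_banach) simp
  then have "(\<lambda>w. (cmod (f (merge W r w)))\<^sup>2) summable_on qbasis W"
    by (simp add: summable_on_reindex[OF inj_on_merge] o_def)
  then show "(\<lambda>w. (cmod (if w \<in> qbasis W then f (merge W r w) else 0))\<^sup>2) summable_on UNIV"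
    by (rule summable_on_cong_neutral[THEN iffD1, rotated -1]) auto
qed

lemma coeff_slice: "coeff (slice W r f) w = (if w \<in> qbasis W then coeff f (merge W r w) else 0)"
  by (simp add: slice.rep_eq)

lemma slice_in_qspace: "slice W r f \<in> qspace W"
  by (simp add: qspace_def coeff_slice)

lemma norm_qspace_has_sum:
  assumes "\<psi> \<in> qspace W"
  shows "((\<lambda>w. (cmod (coeff \<psi> w))\<^sup>2) has_sum (norm \<psi>)\<^sup>2) (qbasis W)"
  by (rule has_sum_cong_neutral[THEN iffD1, OF _ _ _ has_sum_norm_ell2])
    (use assms in \<open>auto simp: qspace_def\<close>)

text \<open>An inequality, since \<open>\<psi>\<close> may have components outside
  \<open>qspace V\<close>.\<close>

lemma norm_slice_has_sum:
  assumes "W \<subseteq> V"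
  obtains s where "((\<lambda>r. (norm (slice W r \<psi>))\<^sup>2) has_sum s) (qbasis (V - W))" "s \<le> (norm \<psi>)\<^sup>2"
proof -
  let ?s = "\<Sum>\<^sub>\<infinity>c\<in>qbasis V. (cmod (coeff \<psi> c))\<^sup>2"
  have "((\<lambda>c. (cmod (coeff \<psi> c))\<^sup>2) has_sum ?s) (qbasis V)"
    by (rule has_sum_infsum[OF coeff_square_summable])
  then have "((\<lambda>(r, w). (cmod (coeff \<psi> (merge W r w)))\<^sup>2) has_sum ?s) (qbasis (V - W) \<times> qbasis W)"
    by (simp only: has_sum_qbasis_split[OF assms, of "\<lambda>c. (cmod (coeff \<psi> c))\<^sup>2"])
  moreover have "((\<lambda>w. (cmod (coeff \<psi> (merge W r w)))\<^sup>2) has_sum (norm (slice W r \<psi>))\<^sup>2) (qbasis W)" for r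
    using norm_qspace_has_sum[OF slice_in_qspace[of W r \<psi>]]
    by (rule has_sum_cong[THEN iffD1, rotated]) (simp add: coeff_slice)
  ultimately have "((\<lambda>r. (norm (slice W r \<psi>))\<^sup>2) has_sum ?s) (qbasis (V - W))"
    using has_sum_SigmaD[where B = "\<lambda>_. qbasis W"] by fastforce
  moreover have "?s \<le> (norm \<psi>)\<^sup>2"
    unfolding norm_ell2_square by (intro infsum_mono2 coeff_square_summable) auto
  ultimately show ?thesis by (rule that)
qed

lemma op_on_clinear: "op_on W A \<Longrightarrow> clinear_op A"
  and op_on_qspace: "op_on W A \<Longrightarrow> blinfun_apply A \<psi> \<in> qspace W"
  by (simp_all add: op_on_def)

text \<open>The tensor product with the identity acts on each slice separately. While
  \<open>ext\<close> prescribes matrix entries, this formula yields the bounded operator that has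
  them.\<close>

definition ext_coeff ::
  "'v qvar set \<Rightarrow> 'v qvar set \<Rightarrow> 'v qop \<Rightarrow> ('v qvar \<Rightarrow> int) ell2 \<Rightarrow> ('v qvar \<Rightarrow> int) \<Rightarrow> complex" where
  "ext_coeff V W A \<psi> c = (if c \<in> qbasis V
     then coeff (blinfun_apply A (slice W (restrict c (V - W)) \<psi>)) (restrict c W) else 0)"

definition ext_apply ::
  "'v qvar set \<Rightarrow> 'v qvar set \<Rightarrow> 'v qop \<Rightarrow> ('v qvar \<Rightarrow> int) ell2 \<Rightarrow> ('v qvar \<Rightarrow> int) ell2" where
  "ext_apply V W A \<psi> = Abs_ell2 (ext_coeff V W A \<psi>)"

context
  fixes V W :: "'v qvar set" and A :: "'v qop"
  assumes W: "W \<subseteq> V" and A: "op_on W A"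
begin

text \<open>One number \<open>s\<close> is both the square sum of the proposed coordinates and the
  total of the squared norms over the slices. The former makes \<open>ext_apply\<close> a vector,
  the latter feeds the contraction estimates.\<close>

lemma ext_apply_norm_aux:
  obtains s where "((\<lambda>c. (cmod (ext_coeff V W A \<psi> c))\<^sup>2) has_sum s) UNIV"
    "((\<lambda>r. (norm (blinfun_apply A (slice W r \<psi>)))\<^sup>2) has_sum s) (qbasis (V - W))"
    "s \<le> (norm A)\<^sup>2 * (norm \<psi>)\<^sup>2"
proof -
  obtain t where t: "((\<lambda>r. (norm (slice W r \<psi>))\<^sup>2) has_sum t) (qbasis (V - W))" "t \<le> (norm \<psi>)\<^sup>2"
    using norm_slice_has_sum[OF W] by blast
  have le: "(norm (blinfun_apply A x))\<^sup>2 \<le> (norm A)\<^sup>2 * (norm x)\<^sup>2" for x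
    using power_mono[OF norm_blinfun[of A x], of 2] by (simp add: power_mult_distrib)
  have t': "((\<lambda>r. (norm A)\<^sup>2 * (norm (slice W r \<psi>))\<^sup>2) has_sum (norm A)\<^sup>2 * t) (qbasis (V - W))"
    by (rule has_sum_cmult_right[OF t(1)])
  have "(\<lambda>r. (norm (blinfun_apply A (slice W r \<psi>)))\<^sup>2) summable_on qbasis (V - W)"
    by (rule summable_on_comparison_test[OF has_sum_imp_summable[OF t']]) (auto simp: le)
  then obtain s where s: "((\<lambda>r. (norm (blinfun_apply A (slice W r \<psi>)))\<^sup>2) has_sum s) (qbasis (V - W))"
    by (auto simp: summable_on_def)
  have inner: "((\<lambda>w. (cmod (ext_coeff V W A \<psi> (merge W r w)))\<^sup>2) has_sum
      (norm (blinfun_apply A (slice W r \<psi>)))\<^sup>2) (qbasis W)" if "r \<in> qbasis (V - W)" for r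
    using norm_qspace_has_sum[OF op_on_qspace[OF A, of "slice W r \<psi>"]]
    by (rule has_sum_cong[THEN iffD1, rotated])
      (use that W in \<open>simp add: ext_coeff_def merge_in_qbasis restrict_merge\<close>)
  have "((\<lambda>(r, w). (cmod (ext_coeff V W A \<psi> (merge W r w)))\<^sup>2) has_sum s) (qbasis (V - W) \<times> qbasis W)"
  proof (rule has_sum_SigmaI[OF _ s])
    show "(\<lambda>(r, w). (cmod (ext_coeff V W A \<psi> (merge W r w)))\<^sup>2) summable_on qbasis (V - W) \<times> qbasis W"
      by (rule summable_on_SigmaI[OF _ has_sum_imp_summable[OF s]]) (auto simp: inner)
  qed (auto simp: inner)
  then have "((\<lambda>c. (cmod (ext_coeff V W A \<psi> c))\<^sup>2) has_sum s) (qbasis V)"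
    by (simp only: has_sum_qbasis_split[OF W, of "\<lambda>c. (cmod (ext_coeff V W A \<psi> c))\<^sup>2"])
  then have "((\<lambda>c. (cmod (ext_coeff V W A \<psi> c))\<^sup>2) has_sum s) UNIV"
    by (rule has_sum_cong_neutral[THEN iffD1, rotated -1]) (auto simp: ext_coeff_def)
  moreover have "s \<le> (norm A)\<^sup>2 * (norm \<psi>)\<^sup>2"
  proof -
    have "s \<le> (norm A)\<^sup>2 * t"
      by (rule has_sum_mono[OF s t']) (rule le)
    also have "\<dots> \<le> (norm A)\<^sup>2 * (norm \<psi>)\<^sup>2"
      using t(2) by (intro mult_left_mono) auto
    finally show ?thesis .
  qed
  ultimately show ?thesis using that s by blast
qed

lemma coeff_ext_apply: "coeff (ext_apply V W A \<psi>) = ext_coeff V W A \<psi>"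
  using ext_apply_norm_aux[of \<psi>] unfolding ext_apply_def
  by (metis Abs_ell2_inverse has_sum_imp_summable mem_Collect_eq)

lemma ext_apply_norm:
  shows "((\<lambda>r. (norm (blinfun_apply A (slice W r \<psi>)))\<^sup>2) has_sum (norm (ext_apply V W A \<psi>))\<^sup>2) (qbasis (V - W))"
    and "(norm (ext_apply V W A \<psi>))\<^sup>2 \<le> (norm A)\<^sup>2 * (norm \<psi>)\<^sup>2"
proof -
  obtain s where s: "((\<lambda>c. (cmod (ext_coeff V W A \<psi> c))\<^sup>2) has_sum s) UNIV"
    "((\<lambda>r. (norm (blinfun_apply A (slice W r \<psi>)))\<^sup>2) has_sum s) (qbasis (V - W))"
    "s \<le> (norm A)\<^sup>2 * (norm \<psi>)\<^sup>2"
    using ext_apply_norm_aux by blast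
  have "s = (norm (ext_apply V W A \<psi>))\<^sup>2"
    using has_sum_norm_ell2[of "ext_apply V W A \<psi>"] s(1) has_sum_unique
    unfolding coeff_ext_apply by blast
  then show "((\<lambda>r. (norm (blinfun_apply A (slice W r \<psi>)))\<^sup>2) has_sum (norm (ext_apply V W A \<psi>))\<^sup>2) (qbasis (V - W))"
    "(norm (ext_apply V W A \<psi>))\<^sup>2 \<le> (norm A)\<^sup>2 * (norm \<psi>)\<^sup>2"
    using s by simp_all
qed

lemma clinear_Blinfun_ext: "clinear_op (Blinfun (ext_apply V W A))"
  and apply_Blinfun_ext: "blinfun_apply (Blinfun (ext_apply V W A)) = ext_apply V W A"
proof -
  have slice_add: "slice W r (f + g) = slice W r f + slice W r g" for r f g
    by (rule coeff_eqI) (simp add: coeff_slice)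
  have slice_scaleC: "slice W r (scaleC z f) = scaleC z (slice W r f)" for r z f
    by (rule coeff_eqI) (simp add: coeff_slice)
  have "ext_apply V W A (f + g) = ext_apply V W A f + ext_apply V W A g" for f g
    by (rule coeff_eqI) (simp add: coeff_ext_apply ext_coeff_def slice_add blinfun.add_right)
  moreover have "ext_apply V W A (scaleC z f) = scaleC z (ext_apply V W A f)" for z f
    by (rule coeff_eqI)
      (simp add: coeff_ext_apply ext_coeff_def slice_scaleC clinear_opD[OF op_on_clinear[OF A]])
  moreover have "norm (ext_apply V W A f) \<le> norm f * norm A" for f
  proof -
    have "(norm (ext_apply V W A f))\<^sup>2 \<le> (norm f * norm A)\<^sup>2"
      using ext_apply_norm(2)[of f] by (simp add: power_mult_distrib mult.commute)
    then show ?thesis by (simp add: power_mono_iff)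
  qed
  ultimately show "clinear_op (Blinfun (ext_apply V W A))"
    "blinfun_apply (Blinfun (ext_apply V W A)) = ext_apply V W A"
    using bounded_clinearI(2,3)[of "ext_apply V W A" "norm A"] by blast+
qed

lemma ext_coeff_ket:
  "ext_coeff V W A (ket d) c =
    (if c \<in> qbasis V \<and> d \<in> qbasis V \<and> restrict c (V - W) = restrict d (V - W)
     then cinner (ket (restrict c W)) (blinfun_apply A (ket (restrict d W))) else 0)"
proof (cases "c \<in> qbasis V")
  case True
  then have r: "restrict c (V - W) \<in> qbasis (V - W)"
    by (intro restrict_in_qbasis) auto
  \<comment> \<open>A basis vector has at most one nonzero slice, the one at its own restriction to
    \<open>V - W\<close>.\<close>
  have "slice W (restrict c (V - W)) (ket d)
      = (if d \<in> qbasis V \<and> restrict c (V - W) = restrict d (V - W) then ket (restrict d W) else 0)"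
    using restrict_in_qbasis[OF _ W]
    by (intro coeff_eqI) (auto simp: coeff_slice merge_eq_iff[OF r _ W])
  then show ?thesis
    using True by (simp add: ext_coeff_def)
qed (simp add: ext_coeff_def)

lemma ext_eq: "ext V W A = Blinfun (ext_apply V W A)"
  unfolding ext_def
  by (rule matrix_op_eqI)
    (simp_all only: clinear_Blinfun_ext apply_Blinfun_ext coeff_ext_apply ext_coeff_ket)

lemma ext_norm_has_sum:
  "((\<lambda>r. (norm (blinfun_apply A (slice W r \<psi>)))\<^sup>2) has_sum (norm (blinfun_apply (ext V W A) \<psi>))\<^sup>2)
    (qbasis (V - W))"
  using ext_apply_norm(1) by (simp add: ext_eq apply_Blinfun_ext)

lemma clinear_ext: "clinear_op (ext V W A)"
  by (simp add: ext_eq clinear_Blinfun_ext)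

lemma coeff_ext_ket:
  "coeff (blinfun_apply (ext V W A) (ket d)) c =
    (if c \<in> qbasis V \<and> d \<in> qbasis V \<and> restrict c (V - W) = restrict d (V - W)
     then coeff (blinfun_apply A (ket (restrict d W))) (restrict c W) else 0)"
  using ext_coeff_ket[of d c] by (simp add: ext_eq apply_Blinfun_ext coeff_ext_apply)

lemma op_on_ext: "op_on V (ext V W A)"
  unfolding op_on_def
proof (intro conjI allI impI)
  show "blinfun_apply (ext V W A) \<psi> \<in> qspace V" for \<psi>
    by (simp add: qspace_def ext_eq apply_Blinfun_ext coeff_ext_apply ext_coeff_def)
  show "blinfun_apply (ext V W A) (ket c) = 0" if "c \<notin> qbasis V" for c
    by (rule coeff_eqI) (simp add: coeff_ext_ket that)
qed (rule clinear_ext)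

end

section \<open>Adjoints and Kraus families of extended operators\<close>

lemma op_on_adj:
  assumes "op_on W A"
  shows "op_on W (adj A)"
proof -
  have cl: "clinear_op A"
    by (rule op_on_clinear[OF assms])
  have "coeff (blinfun_apply (adj A) \<psi>) c = 0" if "c \<notin> qbasis W" for c \<psi>
    using cinner_adj_right[OF cl, of "ket c" \<psi>] assms that by (simp add: op_on_def cinner_simps)
  moreover have "coeff (blinfun_apply (adj A) (ket c)) d = 0" if "c \<notin> qbasis W" for c d
    using op_on_qspace[OF assms, of "ket d"] that by (simp add: coeff_adj[OF cl] qspace_def)
  ultimately show ?thesis
    by (auto simp: op_on_def qspace_def clinear_adj[OF cl] intro!: coeff_eqI)
qed

lemma adj_ext:
  assumes "W \<subseteq> V" "op_on W A"
  shows "adj (ext V W A) = ext V W (adj A)"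
  by (rule adj_matrix_eqI)
    (use assms op_on_adj[OF assms(2)] op_on_clinear[OF assms(2)] in
      \<open>auto simp: clinear_ext coeff_ext_ket coeff_adj\<close>)

text \<open>The contraction inequality holds on every slice. The images are measured slice by slice,
  and the slices of \<open>\<psi>\<close> have total squared norm at most that of
  \<open>\<psi>\<close>.\<close>

lemma kraus_family_ext:
  assumes "W \<subseteq> V" "\<And>m. m \<in> ms \<Longrightarrow> op_on W (M m)"
    and contr: "\<And>N \<phi>. finite N \<Longrightarrow> N \<subseteq> ms \<Longrightarrow> \<phi> \<in> qspace W \<Longrightarrow>
      (\<Sum>m\<in>N. (norm (blinfun_apply (M m) \<phi>))\<^sup>2) \<le> (norm \<phi>)\<^sup>2"
  shows "kraus_family ms (\<lambda>m. ext V W (M m))"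
  unfolding kraus_family_def
proof (intro conjI ballI allI impI)
  show "clinear_op (ext V W (M m))" if "m \<in> ms" for m
    using assms that by (simp add: clinear_ext)
  fix N \<psi>
  assume N: "finite N" "N \<subseteq> ms"
  obtain t where t: "((\<lambda>r. (norm (slice W r \<psi>))\<^sup>2) has_sum t) (qbasis (V - W))" "t \<le> (norm \<psi>)\<^sup>2"
    using norm_slice_has_sum[OF assms(1)] by blast
  have "((\<lambda>r. \<Sum>m\<in>N. (norm (blinfun_apply (M m) (slice W r \<psi>)))\<^sup>2) has_sum
      (\<Sum>m\<in>N. (norm (blinfun_apply (ext V W (M m)) \<psi>))\<^sup>2)) (qbasis (V - W))"
    by (intro has_sum_sum ext_norm_has_sum assms) (use N in auto)
  then have "(\<Sum>m\<in>N. (norm (blinfun_apply (ext V W (M m)) \<psi>))\<^sup>2) \<le> t"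
    by (rule has_sum_mono[OF _ t(1)]) (intro contr N slice_in_qspace)
  then show "(\<Sum>m\<in>N. (norm (blinfun_apply (ext V W (M m)) \<psi>))\<^sup>2) \<le> (norm \<psi>)\<^sup>2"
    using t(2) by simp
qed

text \<open>Pairing the completeness series at \<open>\<phi>\<close> with \<open>\<phi>\<close>
  turns it into the series of squared norms of \<open>M m \<phi>\<close>, whose sum is
  \<open>(norm \<phi>)\<^sup>2\<close>. Convergence on each vector is what this pairing
  uses.\<close>

lemma kraus_family_measurement:
  assumes "W \<subseteq> V" "measurement_on W ms M"
  shows "kraus_family ms (\<lambda>m. ext V W (M m))"
proof (rule kraus_family_ext[OF assms(1)])
  show op: "op_on W (M m)" if "m \<in> ms" for m
    using assms that by (simp add: measurement_on_def)
  fix N \<phi>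
  assume N: "finite N" "N \<subseteq> ms" and \<phi>: "\<phi> \<in> qspace W"
  have "((\<lambda>m. blinfun_apply (adj (M m)) (blinfun_apply (M m) \<phi>)) has_sum \<phi>) ms"
    using assms(2) \<phi> by (simp add: measurement_on_def)
  from has_sum_bounded_linear[OF bounded_linear_inner_right this, of \<phi>]
  have "((\<lambda>m. inner \<phi> (blinfun_apply (adj (M m)) (blinfun_apply (M m) \<phi>))) has_sum inner \<phi> \<phi>) ms"
    by (simp add: o_def)
  then have "((\<lambda>m. (norm (blinfun_apply (M m) \<phi>))\<^sup>2) has_sum inner \<phi> \<phi>) ms"
    by (rule has_sum_cong[THEN iffD1, rotated])
      (simp add: Re_cinner[symmetric] cinner_adj_right[OF op_on_clinear[OF op]] power2_norm_eq_inner)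
  then have "((\<lambda>m. (norm (blinfun_apply (M m) \<phi>))\<^sup>2) has_sum (norm \<phi>)\<^sup>2) ms"
    by (simp add: power2_norm_eq_inner)
  then show "(\<Sum>m\<in>N. (norm (blinfun_apply (M m) \<phi>))\<^sup>2) \<le> (norm \<phi>)\<^sup>2"
    by (rule finite_sum_le_has_sum) (use N in auto)
qed

lemma kraus_family_unitary:
  assumes "W \<subseteq> V" "unitary_on W U"
  shows "kraus_family {m} (\<lambda>_. ext V W U)"
proof (rule kraus_family_ext[OF assms(1)])
  show op: "op_on W U"
    using assms by (simp add: unitary_on_def)
  fix N :: "'b set" and \<phi>
  assume N: "finite N" "N \<subseteq> {m}" and \<phi>: "\<phi> \<in> qspace W"
  have "(norm (blinfun_apply U \<phi>))\<^sup>2 = (norm \<phi>)\<^sup>2"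
    using cinner_adj_right[OF op_on_clinear[OF op], of \<phi> "blinfun_apply U \<phi>"] assms(2) \<phi>
    by (simp add: unitary_on_def power2_norm_eq_inner Re_cinner[symmetric])
  then show "(\<Sum>m\<in>N. (norm (blinfun_apply U \<phi>))\<^sup>2) \<le> (norm \<phi>)\<^sup>2"
    using N by (cases "N = {}") (auto simp: subset_singleton_iff)
qed

lemma ketbra_apply: "blinfun_apply (ketbra a b) \<psi> = scaleC (coeff \<psi> b) (ket a)"
  and clinear_ketbra: "clinear_op (ketbra a b)"
proof -
  define A :: "'a op" where "A = Blinfun (\<lambda>\<psi>. scaleC (coeff \<psi> b) (ket a))"
  have "cmod (coeff f b) \<le> norm f * 1" for f :: "'a ell2"
    using cinner_bound[of "ket b" f] by simp
  then have A: "clinear_op A" "blinfun_apply A = (\<lambda>\<psi>. scaleC (coeff \<psi> b) (ket a))"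
    unfolding A_def
    by (intro bounded_clinearI(2)[where K = 1] bounded_clinearI(3)[where K = 1];
        auto simp: norm_scaleC intro!: coeff_eqI)+
  have "ketbra a b = A"
    unfolding ketbra_def by (rule matrix_op_eqI) (auto simp: A)
  then show "blinfun_apply (ketbra a b) \<psi> = scaleC (coeff \<psi> b) (ket a)" "clinear_op (ketbra a b)"
    by (simp_all add: A)
qed

lemma adj_ketbra: "adj (ketbra a b) = ketbra b a"
  by (rule adj_matrix_eqI) (auto simp: clinear_ketbra ketbra_apply)

lemma op_on_qketbra:
  assumes "i \<in> qdom q" "j \<in> qdom q"
  shows "op_on {q} (qketbra q i j)"
proof -
  have "(\<lambda>x\<in>{q}. i) \<in> qbasis {q}" "(\<lambda>x\<in>{q}. j) \<in> qbasis {q}"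
    using assms by (auto simp: qbasis_def)
  then show ?thesis
    by (auto simp: op_on_def qketbra_def clinear_ketbra ketbra_apply qspace_def intro!: coeff_eqI)
qed

lemma zero_in_qdom: "0 \<in> qdom q"
  by (cases q) auto

lemma adj_ext_qketbra:
  assumes "q \<in> V" "i \<in> qdom q" "j \<in> qdom q"
  shows "adj (ext V {q} (qketbra q i j)) = ext V {q} (qketbra q j i)"
  using assms by (subst adj_ext) (auto simp: op_on_qketbra, simp add: qketbra_def adj_ketbra)

text \<open>The norm of the image under \<open>qketbra q 0 i\<close> is the modulus of one
  coordinate, so the condition is Bessel's inequality. Integer variables give an infinite
  family.\<close>

lemma kraus_family_init:
  assumes "q \<in> V"
  shows "kraus_family (qdom q) (\<lambda>i. ext V {q} (qketbra q 0 i))"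
proof (rule kraus_family_ext)
  fix N \<phi>
  assume N: "finite N" "N \<subseteq> qdom q"
  have inj: "inj_on (\<lambda>i. \<lambda>x\<in>{q}. i) N"
    by (rule inj_onI) (metis restrict_apply' singletonI)
  have "(\<Sum>i\<in>N. (norm (blinfun_apply (qketbra q 0 i) \<phi>))\<^sup>2) = (\<Sum>c\<in>(\<lambda>i. \<lambda>x\<in>{q}. i) ` N. (cmod (coeff \<phi> c))\<^sup>2)"
    by (subst sum.reindex[OF inj]) (simp add: qketbra_def ketbra_apply norm_scaleC)
  also have "\<dots> \<le> (norm \<phi>)\<^sup>2"
    by (rule sum_coeff_square_le) (simp add: N)
  finally show "(\<Sum>i\<in>N. (norm (blinfun_apply (qketbra q 0 i) \<phi>))\<^sup>2) \<le> (norm \<phi>)\<^sup>2" .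
qed (use assms in \<open>auto simp: op_on_qketbra zero_in_qdom\<close>)

section \<open>Superoperators on partial density operators\<close>

lemma partial_density_iff:
  "partial_density V \<rho> \<longleftrightarrow> op_on V \<rho> \<and> trace_pos \<rho> \<and> trace \<rho> \<le> 1"
proof (cases "positive \<rho>")
  case True
  have eq: "cinner (ket c) (blinfun_apply \<rho> (ket c)) = of_real (diag \<rho> c)" for c
    unfolding diag_def by (rule cinner_quad[OF True])
  have "(\<lambda>c. complex_of_real (diag \<rho> c)) summable_on UNIV \<longleftrightarrow> diag \<rho> summable_on UNIV"
    using summable_on_Re[of "\<lambda>c. complex_of_real (diag \<rho> c)" UNIV] summable_on_of_real[of "diag \<rho>" UNIV]
    by auto
  moreover have "Re (\<Sum>\<^sub>\<infinity>c. complex_of_real (diag \<rho> c)) = trace \<rho>" if "diag \<rho> summable_on UNIV"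
    using infsum_Re[OF summable_on_of_real[OF that]] by (simp add: trace_def)
  ultimately show ?thesis
    using True by (auto simp: partial_density_def trace_le_1_def eq trace_pos_def simp del: cinner_ket)
qed (auto simp: partial_density_def trace_pos_def)

lemma op_on_iff:
  "op_on V A \<longleftrightarrow> clinear_op A \<and> (\<forall>c. c \<notin> qbasis V \<longrightarrow>
    (\<forall>\<psi>. coeff (blinfun_apply A \<psi>) c = 0) \<and> (\<forall>d. coeff (blinfun_apply A (ket c)) d = 0))"
  by (auto simp: op_on_def qspace_def intro: coeff_eqI)

lemma op_on_0 [simp]: "op_on V 0"
  and op_on_add: "op_on V A \<Longrightarrow> op_on V B \<Longrightarrow> op_on V (A + B)"
  and op_on_diff: "op_on V A \<Longrightarrow> op_on V B \<Longrightarrow> op_on V (A - B)"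
  by (auto simp: op_on_iff clinear_op_add clinear_op_diff blinfun.add_left blinfun.diff_left)

lemma op_on_sum: "(\<And>j. j \<in> J \<Longrightarrow> op_on V (f j)) \<Longrightarrow> op_on V (sum f J)"
  by (induction J rule: infinite_finite_induct) (auto intro: op_on_add)

lemma op_on_has_sum:
  assumes "(f has_sum s) J" "\<And>j. j \<in> J \<Longrightarrow> op_on V (f j)"
  shows "op_on V s"
proof -
  have coeff: "coeff (blinfun_apply s \<psi>) c = 0" if "\<And>j. j \<in> J \<Longrightarrow> coeff (blinfun_apply (f j) \<psi>) c = 0" for \<psi> c
  proof -
    have "((\<lambda>j. coeff (blinfun_apply (f j) \<psi>) c) has_sum coeff (blinfun_apply s \<psi>) c) J"
      by (rule has_sum_bounded_linear[OF bounded_linear_compose[OF bounded_linear_coeff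
              blinfun.bounded_linear_left] assms(1), unfolded o_def])
    moreover have "((\<lambda>j. coeff (blinfun_apply (f j) \<psi>) c) has_sum 0) J"
      by (rule has_sum_0) (rule that)
    ultimately show ?thesis by (rule has_sum_unique)
  qed
  show ?thesis
    unfolding op_on_iff
    using clinear_op_has_sum[OF assms(1)] assms(2) by (auto simp: op_on_iff intro!: coeff)
qed

lemma op_on_sandwich:
  assumes "op_on V B" "clinear_op \<rho>"
  shows "op_on V (sandwich B (adj B) \<rho>)"
  using assms op_on_adj[OF assms(1)]
  by (auto simp: op_on_def sandwich_def clinear_op_compose)

text \<open>All conditions are restricted to partial densities because the description in
  \<open>superop_lub\<close> is controlled only there. Additivity is accordingly asked for when the
  sum is again a partial density; with the trace bound it extends to infinite sums.\<close>

definition superop_on :: "'v qvar set \<Rightarrow> 'v superop \<Rightarrow> bool" where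
  "superop_on V F \<longleftrightarrow>
     (\<forall>\<rho>. partial_density V \<rho> \<longrightarrow> partial_density V (F \<rho>) \<and> trace (F \<rho>) \<le> trace \<rho>) \<and>
     (\<forall>\<rho> \<sigma>. partial_density V \<rho> \<longrightarrow> partial_density V \<sigma> \<longrightarrow> partial_density V (\<rho> + \<sigma>) \<longrightarrow>
        F (\<rho> + \<sigma>) = F \<rho> + F \<sigma>)"

lemma superop_onI:
  assumes "\<And>\<rho>. partial_density V \<rho> \<Longrightarrow> op_on V (F \<rho>)"
    "\<And>\<rho>. partial_density V \<rho> \<Longrightarrow> trace_pos (F \<rho>)"
    "\<And>\<rho>. partial_density V \<rho> \<Longrightarrow> trace (F \<rho>) \<le> trace \<rho>"
    "\<And>\<rho> \<sigma>. partial_density V \<rho> \<Longrightarrow> partial_density V \<sigma> \<Longrightarrow> partial_density V (\<rho> + \<sigma>) \<Longrightarrow>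
        F (\<rho> + \<sigma>) = F \<rho> + F \<sigma>"
  shows "superop_on V F"
  using assms unfolding superop_on_def by (force simp: partial_density_iff)

lemma
  assumes "superop_on V F" "partial_density V \<rho>"
  shows superop_on_pd: "partial_density V (F \<rho>)"
    and superop_on_trace: "trace (F \<rho>) \<le> trace \<rho>"
  using assms by (auto simp: superop_on_def)

lemma superop_on_add:
  "superop_on V F \<Longrightarrow> partial_density V \<rho> \<Longrightarrow> partial_density V \<sigma> \<Longrightarrow> partial_density V (\<rho> + \<sigma>) \<Longrightarrow>
    F (\<rho> + \<sigma>) = F \<rho> + F \<sigma>"
  by (simp add: superop_on_def)

lemma superop_on_cong:
  assumes "superop_on V F" "\<And>\<rho>. partial_density V \<rho> \<Longrightarrow> F \<rho> = G \<rho>"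
  shows "superop_on V G"
  using assms unfolding superop_on_def by metis

lemma pd_trace_pos: "partial_density V \<rho> \<Longrightarrow> trace_pos \<rho>"
  and pd_positive: "partial_density V \<rho> \<Longrightarrow> positive \<rho>"
  and pd_op_on: "partial_density V \<rho> \<Longrightarrow> op_on V \<rho>"
  by (auto simp: partial_density_iff trace_posD)

lemma partial_density_0 [simp]: "partial_density V 0"
  by (simp add: partial_density_iff)

lemma partial_density_le:
  assumes "partial_density V \<sigma>" "op_on V \<rho>" "positive \<rho>" "positive (\<sigma> - \<rho>)"
  shows "partial_density V \<rho>" "trace \<rho> \<le> trace \<sigma>"
  using trace_pos_mono[of \<sigma> \<rho>] assms by (auto simp: partial_density_iff)

(* Finite additivity suffices: the image of the remainder of the series has at most the trace of
   the remainder, which tends to 0. *)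
lemma superop_on_has_sum:
  assumes F: "superop_on V F" and f: "\<And>j. j \<in> J \<Longrightarrow> partial_density V (f j)"
    and s: "(f has_sum s) J" "partial_density V s"
  shows "((\<lambda>j. F (f j)) has_sum F s) J"
proof -
  have part: "partial_density V (sum f N)" "partial_density V (s - sum f N)"
    "trace (s - sum f N) = trace s - (\<Sum>j\<in>N. trace (f j))" if N: "finite N" "N \<subseteq> J" for N
  proof -
    have op: "op_on V (sum f N)"
      using f N by (intro op_on_sum pd_op_on) auto
    have rem: "positive (s - sum f N)"
      by (rule positive_has_sum[OF has_sum_minus_partial[OF s(1) N]]) (use f pd_positive in auto)
    have pos: "positive (sum f N)"
      using f N by (intro positive_sum pd_positive) auto
    show pd: "partial_density V (sum f N)"
      by (rule partial_density_le[OF s(2) op pos rem])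
    show pd': "partial_density V (s - sum f N)"
      by (rule partial_density_le[OF s(2) _ rem]) (use op s pos in \<open>auto intro: op_on_diff pd_op_on\<close>)
    have "trace (sum f N) = (\<Sum>j\<in>N. trace (f j))"
      using trace_pos_sum[of N f] f N pd_trace_pos by blast
    then show "trace (s - sum f N) = trace s - (\<Sum>j\<in>N. trace (f j))"
      using trace_pos_add(2)[OF pd_trace_pos[OF pd] pd_trace_pos[OF pd']] by simp
  qed
  have F0: "F 0 = 0"
    using F partial_density_0[of V] unfolding superop_on_def by (metis add_0 add_left_cancel add.right_neutral)
  have F_sum: "F (sum f N) = (\<Sum>j\<in>N. F (f j))" if "finite N" "N \<subseteq> J" for N
    using that
  proof induction
    case (insert j N)
    then have "F (f j + sum f N) = F (f j) + F (sum f N)"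
      using F f[of j] part(1)[of N] part(1)[of "insert j N"] unfolding superop_on_def by auto
    then show ?case using insert by simp
  qed (simp add: F0)
  have "((\<lambda>j. trace (f j)) has_sum trace s) J"
    by (rule has_sum_imp_trace_has_sum[OF _ s(1)]) (use f s in \<open>auto intro: pd_trace_pos\<close>)
  then have lim: "(sum (\<lambda>j. trace (f j)) \<longlongrightarrow> trace s) (finite_subsets_at_top J)"
    by (simp add: has_sum_def)
  have "dist (\<Sum>j\<in>N. F (f j)) (F s) \<le> dist (\<Sum>j\<in>N. trace (f j)) (trace s)" if N: "finite N" "N \<subseteq> J" for N
  proof -
    have "F (sum f N + (s - sum f N)) = F (sum f N) + F (s - sum f N)"
      by (rule superop_on_add[OF F part(1,2)[OF N]]) (simp add: s(2))
    then have "F s - (\<Sum>j\<in>N. F (f j)) = F (s - sum f N)"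
      by (simp add: F_sum N)
    then have "dist (\<Sum>j\<in>N. F (f j)) (F s) = norm (F (s - sum f N))"
      by (simp add: dist_norm norm_minus_commute)
    also have "\<dots> \<le> trace (F (s - sum f N))"
      by (intro norm_le_trace pd_trace_pos[OF superop_on_pd[OF F]] part N)
    also have "\<dots> \<le> trace (s - sum f N)"
      by (intro superop_on_trace[OF F] part N)
    finally show ?thesis
      by (simp add: part N dist_real_def)
  qed
  then show ?thesis
    unfolding has_sum_def
    by (intro metric_tendsto_imp_tendsto[OF lim] eventually_finite_subsets_at_top_weakI) auto
qed

text \<open>Since \<open>infsum\<close> is 0 for a divergent series, the second conclusion records
  that the series does converge. The bound on finite sums of traces yields both this and the trace
  inequality.\<close>

lemma superop_on_family:
  assumes "\<And>j. j \<in> J \<Longrightarrow> superop_on V (H j)"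
    and bound: "\<And>\<rho> N. partial_density V \<rho> \<Longrightarrow> finite N \<Longrightarrow> N \<subseteq> J \<Longrightarrow> (\<Sum>j\<in>N. trace (H j \<rho>)) \<le> trace \<rho>"
  shows "superop_on V (\<lambda>\<rho>. \<Sum>\<^sub>\<infinity>j\<in>J. H j \<rho>)"
    and "\<And>\<rho>. partial_density V \<rho> \<Longrightarrow> ((\<lambda>j. H j \<rho>) has_sum (\<Sum>\<^sub>\<infinity>j\<in>J. H j \<rho>)) J"
proof -
  have tp: "trace_pos (H j \<rho>)" if "partial_density V \<rho>" "j \<in> J" for j \<rho>
    using assms that by (auto intro: pd_trace_pos superop_on_pd)
  have trace: "((\<lambda>j. trace (H j \<rho>)) has_sum (\<Sum>\<^sub>\<infinity>j\<in>J. trace (H j \<rho>))) J"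
    if "partial_density V \<rho>" for \<rho>
    using that bound[OF that]
    by (intro has_sum_infsum nonneg_bdd_above_summable_on bdd_aboveI2[where M = "trace \<rho>"])
      (auto intro: trace_nonneg trace_posD tp)
  have *: "(\<lambda>j. H j \<rho>) summable_on J" "trace_pos (\<Sum>\<^sub>\<infinity>j\<in>J. H j \<rho>)"
    "trace (\<Sum>\<^sub>\<infinity>j\<in>J. H j \<rho>) = (\<Sum>\<^sub>\<infinity>j\<in>J. trace (H j \<rho>))" if "partial_density V \<rho>" for \<rho>
    using trace_summable_imp_has_sum[OF tp[OF that] trace[OF that]] by auto
  show has_sum: "((\<lambda>j. H j \<rho>) has_sum (\<Sum>\<^sub>\<infinity>j\<in>J. H j \<rho>)) J" if "partial_density V \<rho>" for \<rho>
    using *(1)[OF that] by simp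
  show "superop_on V (\<lambda>\<rho>. \<Sum>\<^sub>\<infinity>j\<in>J. H j \<rho>)"
  proof (rule superop_onI)
    fix \<rho>
    assume \<rho>: "partial_density V \<rho>"
    show "op_on V (\<Sum>\<^sub>\<infinity>j\<in>J. H j \<rho>)"
      by (rule op_on_has_sum[OF has_sum[OF \<rho>]]) (use assms \<rho> in \<open>auto intro: pd_op_on superop_on_pd\<close>)
    show "trace_pos (\<Sum>\<^sub>\<infinity>j\<in>J. H j \<rho>)"
      by (rule *(2)[OF \<rho>])
    show "trace (\<Sum>\<^sub>\<infinity>j\<in>J. H j \<rho>) \<le> trace \<rho>"
      unfolding *(3)[OF \<rho>] using trace[OF \<rho>]
      by (rule has_sum_le_finite_sums) (use bound \<rho> in auto)
    fix \<sigma>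
    assume \<sigma>: "partial_density V \<sigma>" "partial_density V (\<rho> + \<sigma>)"
    have "(\<Sum>\<^sub>\<infinity>j\<in>J. H j (\<rho> + \<sigma>)) = (\<Sum>\<^sub>\<infinity>j\<in>J. H j \<rho> + H j \<sigma>)"
      by (rule infsum_cong) (use assms(1) \<rho> \<sigma> in \<open>auto simp: superop_on_def\<close>)
    then show "(\<Sum>\<^sub>\<infinity>j\<in>J. H j (\<rho> + \<sigma>)) = (\<Sum>\<^sub>\<infinity>j\<in>J. H j \<rho>) + (\<Sum>\<^sub>\<infinity>j\<in>J. H j \<sigma>)"
      using infsum_add[OF *(1)[OF \<rho>] *(1)[OF \<sigma>(1)]] by simp
  qed
qed

lemma superop_on_compose:
  assumes "superop_on V F" "superop_on V G"
  shows "superop_on V (G \<circ> F)"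
  unfolding superop_on_def
proof (intro conjI allI impI)
  fix \<rho>
  assume \<rho>: "partial_density V \<rho>"
  note F\<rho> = superop_on_pd[OF assms(1) \<rho>]
  show "partial_density V ((G \<circ> F) \<rho>)"
    using superop_on_pd[OF assms(2) F\<rho>] by simp
  show "trace ((G \<circ> F) \<rho>) \<le> trace \<rho>"
    using superop_on_trace[OF assms(2) F\<rho>] superop_on_trace[OF assms(1) \<rho>] by simp
  fix \<sigma>
  assume \<sigma>: "partial_density V \<sigma>" "partial_density V (\<rho> + \<sigma>)"
  have "F (\<rho> + \<sigma>) = F \<rho> + F \<sigma>"
    using assms(1) \<rho> \<sigma> by (simp add: superop_on_def)
  moreover from this have "partial_density V (F \<rho> + F \<sigma>)"
    using superop_on_pd[OF assms(1) \<sigma>(2)] by simp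
  ultimately show "(G \<circ> F) (\<rho> + \<sigma>) = (G \<circ> F) \<rho> + (G \<circ> F) \<sigma>"
    using assms(2) F\<rho> superop_on_pd[OF assms(1) \<sigma>(1)] by (simp add: superop_on_def)
qed

lemma superop_on_id: "superop_on V (\<lambda>\<rho>. \<rho>)"
  by (simp add: superop_on_def)

lemma superop_on_0: "superop_on V (\<lambda>_. 0)"
  by (auto simp: superop_on_def trace_nonneg pd_positive)

lemma superop_on_sandwich:
  assumes "kraus_family J B" "j \<in> J" "op_on V (B j)"
  shows "superop_on V (sandwich (B j) (adj (B j)))"
proof (rule superop_onI)
  fix \<rho>
  assume \<rho>: "partial_density V \<rho>"
  show "op_on V (sandwich (B j) (adj (B j)) \<rho>)"
    by (rule op_on_sandwich[OF assms(3)]) (rule op_on_clinear[OF pd_op_on[OF \<rho>]])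
  show "trace_pos (sandwich (B j) (adj (B j)) \<rho>)"
    by (rule trace_pos_kraus[OF assms(1) pd_trace_pos[OF \<rho>] assms(2)])
  show "trace (sandwich (B j) (adj (B j)) \<rho>) \<le> trace \<rho>"
    using trace_kraus_sum_le[OF assms(1) pd_trace_pos[OF \<rho>], of "{j}"] assms(2) by simp
qed (auto simp: sandwich_def blinfun.add_left blinfun.add_right intro: blinfun_eqI)

text \<open>\<open>G j\<close> stands for what follows branch \<open>j\<close>: the identity for
  initialization, the meaning of the branch for a measurement. As no \<open>G j\<close> raises the
  trace, the bound for the Kraus family carries over.\<close>

lemma superop_on_kraus_sum:
  assumes "kraus_family J B" "\<And>j. j \<in> J \<Longrightarrow> op_on V (B j)" "\<And>j. j \<in> J \<Longrightarrow> superop_on V (G j)"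
  shows "superop_on V (\<lambda>\<rho>. \<Sum>\<^sub>\<infinity>j\<in>J. G j (sandwich (B j) (adj (B j)) \<rho>))"
    and "\<And>\<rho>. partial_density V \<rho> \<Longrightarrow> ((\<lambda>j. G j (sandwich (B j) (adj (B j)) \<rho>)) has_sum
      (\<Sum>\<^sub>\<infinity>j\<in>J. G j (sandwich (B j) (adj (B j)) \<rho>))) J"
proof -
  have K: "superop_on V (sandwich (B j) (adj (B j)))" if "j \<in> J" for j
    by (rule superop_on_sandwich[OF assms(1) that assms(2)[OF that]])
  have GK: "superop_on V (\<lambda>\<rho>. G j (sandwich (B j) (adj (B j)) \<rho>))" if "j \<in> J" for j
    using superop_on_compose[OF K assms(3)] that by (simp add: o_def)
  have bound: "(\<Sum>j\<in>N. trace (G j (sandwich (B j) (adj (B j)) \<rho>))) \<le> trace \<rho>"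
    if "partial_density V \<rho>" "finite N" "N \<subseteq> J" for \<rho> N
  proof -
    have "(\<Sum>j\<in>N. trace (G j (sandwich (B j) (adj (B j)) \<rho>)))
        \<le> (\<Sum>j\<in>N. trace (sandwich (B j) (adj (B j)) \<rho>))"
      by (intro sum_mono superop_on_trace[OF assms(3)] superop_on_pd[OF K that(1)])
        (use that in auto)
    also have "\<dots> \<le> trace \<rho>"
      using that by (intro trace_kraus_sum_le[OF assms(1)] pd_trace_pos)
    finally show ?thesis .
  qed
  note * = superop_on_family[where H = "\<lambda>j \<rho>. G j (sandwich (B j) (adj (B j)) \<rho>)", OF GK bound]
  show "superop_on V (\<lambda>\<rho>. \<Sum>\<^sub>\<infinity>j\<in>J. G j (sandwich (B j) (adj (B j)) \<rho>))"
    by (rule *(1))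
  show "((\<lambda>j. G j (sandwich (B j) (adj (B j)) \<rho>)) has_sum
      (\<Sum>\<^sub>\<infinity>j\<in>J. G j (sandwich (B j) (adj (B j)) \<rho>))) J" if "partial_density V \<rho>" for \<rho>
    by (rule *(2)) (use that in auto)
qed

lemma superop_on_init:
  assumes "q \<in> V"
  shows "superop_on V (init_superop V q)"
proof (rule superop_on_cong)
  let ?B = "\<lambda>i. ext V {q} (qketbra q 0 i)"
  show "superop_on V (\<lambda>\<rho>. \<Sum>\<^sub>\<infinity>i\<in>qdom q. sandwich (?B i) (adj (?B i)) \<rho>)"
    by (rule superop_on_kraus_sum(1)[OF kraus_family_init[OF assms] _ superop_on_id])
      (use assms in \<open>auto intro!: op_on_ext op_on_qketbra zero_in_qdom\<close>)
  show "(\<Sum>\<^sub>\<infinity>i\<in>qdom q. sandwich (?B i) (adj (?B i)) \<rho>) = init_superop V q \<rho>" for \<rho>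
    unfolding init_superop_def
    by (rule infsum_cong) (simp add: adj_ext_qketbra assms zero_in_qdom)
qed

lemma superop_on_unitary:
  assumes "set qs \<subseteq> V" "unitary_on (set qs) U"
  shows "superop_on V (conj_superop V qs U)"
  unfolding conj_superop_def
  using superop_on_sandwich[OF kraus_family_unitary[OF assms, where m = "()"]] assms
  by (auto simp: unitary_on_def op_on_ext)

section \<open>Computations\<close>

type_synonym ('v, 'm) path = "'m label list \<times> 'v superop"

(* The terminating computations from S, each as its label sequence together with its effect on
   the state; X i are the computations from Call i. *)
primrec paths :: "'v qvar set \<Rightarrow> (nat \<Rightarrow> ('v, 'm) path set) \<Rightarrow> ('v, 'm) stmt \<Rightarrow> ('v, 'm) path set" where
  "paths V X Bottom = {([Eps], \<lambda>_. 0)}"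
| "paths V X Skip = {([Eps], \<lambda>\<rho>. \<rho>)}"
| "paths V X (Init q) = {([Eps], init_superop V q)}"
| "paths V X (Unitary qs U) = {([Eps], conj_superop V qs U)}"
| "paths V X (Seq S T) =
     (\<lambda>(p, q). (fst p @ fst q, snd q \<circ> snd p)) ` (paths V X S \<times> paths V X T)"
| "paths V X (Cond qs ms M P) =
     (\<lambda>(m, p). (Outcome m # fst p, snd p \<circ> conj_superop V qs (M m))) ` (SIGMA m:ms. paths V X (P m))"
| "paths V X (Call i) = X i"

text \<open>The leading \<open>Eps\<close> is the unfolding step of the call. At depth 0 there are
  no computations although the approximant is \<open>Bottom\<close>, which has one: the effect of
  \<open>Bottom\<close> is 0, so the sums agree, and \<open>Call i\<close> acquires no spurious
  label sequence.\<close>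

primrec call_paths :: "'v qvar set \<Rightarrow> ('v, 'm) stmt list \<Rightarrow> nat \<Rightarrow> nat \<Rightarrow> ('v, 'm) path set" where
  "call_paths V D 0 i = {}"
| "call_paths V D (Suc k) i = (if i < length D
     then (\<lambda>p. (Eps # fst p, snd p)) ` paths V (call_paths V D k) (D ! i) else {})"

text \<open>Quantifying over continuations says at once that no label sequence is a proper prefix of
  another and that a label sequence determines its effect. It also fits the concatenations that
  arise for \<open>Seq\<close>.\<close>

definition prefix_free :: "('v, 'm) path set \<Rightarrow> bool" where
  "prefix_free X \<longleftrightarrow> (\<forall>p\<in>X. \<forall>q\<in>X. \<forall>\<gamma> \<delta>. fst p @ \<gamma> = fst q @ \<delta> \<longrightarrow> p = q)"

lemma prefix_freeD:
  "prefix_free X \<Longrightarrow> p \<in> X \<Longrightarrow> q \<in> X \<Longrightarrow> fst p @ \<gamma> = fst q @ \<delta> \<Longrightarrow> p = q"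
  by (auto simp: prefix_free_def)

text \<open>For \<open>Seq\<close> the first factors are compared with everything after them as
  continuation; once equal they cancel, and the second factors are compared. For \<open>Cond\<close>
  the outcome label selects the branch.\<close>

lemma prefix_free_paths:
  assumes "\<And>i. prefix_free (X i)"
  shows "prefix_free (paths V X S)"
proof (induction S)
  case (Seq S T)
  show ?case
    unfolding prefix_free_def
  proof clarsimp
    fix a F b G a' F' b' G' \<gamma> \<delta>
    assume *: "(a, F) \<in> paths V X S" "(b, G) \<in> paths V X T"
      "(a', F') \<in> paths V X S" "(b', G') \<in> paths V X T" "a @ b @ \<gamma> = a' @ b' @ \<delta>"
    have "(a, F) = (a', F')"
      by (rule prefix_freeD[OF Seq.IH(1)]) (use * in auto)
    moreover from this have "(b, G) = (b', G')"
      by (intro prefix_freeD[OF Seq.IH(2)]) (use * in auto)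
    ultimately show "a @ b = a' @ b' \<and> G \<circ> F = G' \<circ> F'"
      by simp
  qed
next
  case (Cond qs ms M P)
  show ?case
    unfolding prefix_free_def
  proof clarsimp
    fix m a F a' F' \<gamma> \<delta>
    assume "m \<in> ms" "(a, F) \<in> paths V X (P m)" "(a', F') \<in> paths V X (P m)" "a @ \<gamma> = a' @ \<delta>"
    then have "(a, F) = (a', F')"
      using prefix_freeD[OF Cond.IH[of "P m"], of "(a, F)" "(a', F')"] by auto
    then show "a = a' \<and> F \<circ> conj_superop V qs (M m) = F' \<circ> conj_superop V qs (M m)"
      by simp
  qed
qed (auto simp: assms, auto simp: prefix_free_def)

lemma paths_mono: "(\<And>i. X i \<subseteq> Y i) \<Longrightarrow> paths V X S \<subseteq> paths V Y S"
proof (induction S)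
  case (Seq S T)
  have "paths V X S \<subseteq> paths V Y S" "paths V X T \<subseteq> paths V Y T"
    using Seq by blast+
  then show ?case
    unfolding paths.simps by (intro image_mono Sigma_mono)
next
  case (Cond qs ms M P)
  then show ?case
    unfolding paths.simps by (intro image_mono Sigma_mono) auto
qed simp_all

lemma incseq_call_paths: "incseq (\<lambda>k. call_paths V D k i)"
proof (rule incseq_SucI)
  show "call_paths V D k i \<subseteq> call_paths V D (Suc k) i" for k
  proof (induction k arbitrary: i)
    case (Suc k)
    have "paths V (call_paths V D k) S \<subseteq> paths V (call_paths V D (Suc k)) S" for S
      by (rule paths_mono) (rule Suc.IH)
    then show ?case by auto
  qed simp
qed

lemma prefix_free_call_paths: "prefix_free (call_paths V D k i)"
proof (induction k arbitrary: i)
  case (Suc k)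
  have free: "prefix_free (paths V (call_paths V D k) (D ! i))"
    by (rule prefix_free_paths) (rule Suc.IH)
  show ?case
    unfolding prefix_free_def
  proof (clarsimp split: if_splits)
    fix a F a' F' \<gamma> \<delta>
    assume "(a, F) \<in> paths V (call_paths V D k) (D ! i)" "(a', F') \<in> paths V (call_paths V D k) (D ! i)"
      "a @ \<gamma> = a' @ \<delta>"
    then show "a = a' \<and> F = F'"
      using prefix_freeD[OF free, of "(a, F)" "(a', F')"] by auto
  qed
qed (simp add: prefix_free_def)

lemma prefix_free_UN:
  fixes X :: "nat \<Rightarrow> ('v, 'm) path set"
  assumes "incseq X" "\<And>k. prefix_free (X k)"
  shows "prefix_free (\<Union>k. X k)"
  unfolding prefix_free_def
proof (intro ballI allI impI)
  fix p q \<gamma> \<delta>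
  assume "p \<in> (\<Union>k. X k)" "q \<in> (\<Union>k. X k)" and eq: "fst p @ \<gamma> = fst q @ \<delta>"
  then obtain k l where "p \<in> X k" "q \<in> X l" by auto
  then have "p \<in> X (max k l)" "q \<in> X (max k l)"
    using incseqD[OF assms(1), of k "max k l"] incseqD[OF assms(1), of l "max k l"] by auto
  then show "p = q"
    using prefix_freeD[OF assms(2)] eq by blast
qed

text \<open>A terminating computation makes finitely many calls, so it has a finite depth.
  Infinitely many branches in \<open>Cond\<close> do no harm, since a computation takes one of them;
  \<open>Seq\<close> joins two depths by their maximum.\<close>

lemma paths_UN_subset:
  fixes X :: "nat \<Rightarrow> nat \<Rightarrow> ('v, 'm) path set"
  assumes "\<And>i. incseq (\<lambda>k. X k i)"
  shows "paths V (\<lambda>i. \<Union>k. X k i) S \<subseteq> (\<Union>k. paths V (X k) S)"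
proof (induction S)
  case (Seq S T)
  have mono: "paths V (X k) S' \<subseteq> paths V (X l) S'" if "k \<le> l" for k l and S' :: "('v, 'm) stmt"
    by (rule paths_mono) (use incseqD[OF assms] that in blast)
  show ?case
  proof
    fix r
    assume "r \<in> paths V (\<lambda>i. \<Union>k. X k i) (Seq S T)"
    then obtain p q where r: "r = (fst p @ fst q, snd q \<circ> snd p)"
      and "p \<in> paths V (\<lambda>i. \<Union>k. X k i) S" "q \<in> paths V (\<lambda>i. \<Union>k. X k i) T"
      by auto
    then obtain k l where "p \<in> paths V (X k) S" "q \<in> paths V (X l) T"
      using Seq.IH by blast
    then have "p \<in> paths V (X (max k l)) S" "q \<in> paths V (X (max k l)) T"
      using mono[of k "max k l" S] mono[of l "max k l" T] by auto
    then have "r \<in> paths V (X (max k l)) (Seq S T)"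
      by (force simp: r)
    then show "r \<in> (\<Union>k. paths V (X k) (Seq S T))" by blast
  qed
next
  case (Cond qs ms M P)
  then have IH: "paths V (\<lambda>i. \<Union>k. X k i) (P m) \<subseteq> (\<Union>k. paths V (X k) (P m))" for m
    by auto
  show ?case
  proof
    fix r
    assume "r \<in> paths V (\<lambda>i. \<Union>k. X k i) (Cond qs ms M P)"
    then obtain m p where r: "r = (Outcome m # fst p, snd p \<circ> conj_superop V qs (M m))"
      and "m \<in> ms" "p \<in> paths V (\<lambda>i. \<Union>k. X k i) (P m)"
      by auto
    then obtain k where "p \<in> paths V (X k) (P m)"
      using IH by blast
    then have "r \<in> paths V (X k) (Cond qs ms M P)"
      using \<open>m \<in> ms\<close> by (force simp: r)
    then show "r \<in> (\<Union>k. paths V (X k) (Cond qs ms M P))" by blast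
  qed
qed auto

section \<open>The denotation as a sum over computations\<close>

text \<open>Every member of \<open>X\<close> has to behave well on all partial densities, because in
  a composition it is applied to intermediate states.\<close>

definition represents :: "'v qvar set \<Rightarrow> ('v, 'm) path set \<Rightarrow> 'v superop \<Rightarrow> bool" where
  "represents V X F \<longleftrightarrow> superop_on V F \<and> (\<forall>p\<in>X. superop_on V (snd p)) \<and>
     (\<forall>\<rho>. partial_density V \<rho> \<longrightarrow> ((\<lambda>p. snd p \<rho>) has_sum F \<rho>) X)"

lemma represents_singleton: "superop_on V F \<Longrightarrow> represents V {(\<alpha>, F)} F"
  by (auto simp: represents_def intro: has_sum_finiteI)

lemma represents_imageI:
  assumes "inj_on g A" "superop_on V F" "\<And>x. x \<in> A \<Longrightarrow> superop_on V (snd (g x))"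
    "\<And>\<rho>. partial_density V \<rho> \<Longrightarrow> ((\<lambda>x. snd (g x) \<rho>) has_sum F \<rho>) A"
  shows "represents V (g ` A) F"
  using assms by (auto simp: represents_def has_sum_reindex o_def)

lemma represents_relabel:
  assumes "represents V X F" "inj_on g (fst ` X)"
  shows "represents V ((\<lambda>p. (g (fst p), snd p)) ` X) F"
  by (rule represents_imageI) (use assms in \<open>auto simp: represents_def inj_on_def\<close>)

text \<open>Countable additivity moves \<open>G\<close> inside the sum for \<open>F\<close>, and the
  traces join the iterated sum into one over \<open>X \<times> Y\<close>. Prefix-freeness makes the
  composition map injective; otherwise the image set would count merged pairs only once.\<close>

lemma represents_Seq:
  fixes X Y :: "('v, 'm) path set"
  assumes X: "represents V X F" "prefix_free X" and Y: "represents V Y G" "prefix_free Y"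
  shows "represents V ((\<lambda>(p, q). (fst p @ fst q, snd q \<circ> snd p)) ` (X \<times> Y)) (G \<circ> F)"
proof -
  have inj: "inj_on (\<lambda>(p, q). (fst p @ fst q, snd q \<circ> snd p)) (X \<times> Y)"
  proof (rule inj_onI, clarsimp)
    fix a K b L a' K' b' L'
    assume *: "(a, K) \<in> X" "(b, L) \<in> Y" "(a', K') \<in> X" "(b', L') \<in> Y" "a @ b = a' @ b'"
    have "(a, K) = (a', K')"
      by (rule prefix_freeD[OF X(2)]) (use * in auto)
    moreover from this have "(b, L) = (b', L')"
      by (intro prefix_freeD[OF Y(2), where \<gamma> = "[]" and \<delta> = "[]"]) (use * in auto)
    ultimately show "a = a' \<and> K = K' \<and> b = b' \<and> L = L'" by simp
  qed
  have sF: "superop_on V F" and sG: "superop_on V G"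
    and sX: "\<And>p. p \<in> X \<Longrightarrow> superop_on V (snd p)" and sY: "\<And>p. p \<in> Y \<Longrightarrow> superop_on V (snd p)"
    using assms by (auto simp: represents_def)
  have "((\<lambda>(p, q). snd q (snd p \<rho>)) has_sum G (F \<rho>)) (X \<times> Y)" if \<rho>: "partial_density V \<rho>" for \<rho>
  proof (rule trace_has_sum_SigmaI[where g = "\<lambda>p. G (snd p \<rho>)"])
    show "((\<lambda>p. G (snd p \<rho>)) has_sum G (F \<rho>)) X"
      by (rule superop_on_has_sum[OF sG])
        (use X(1) \<rho> sX sF in \<open>auto simp: represents_def intro: superop_on_pd\<close>)
    show "((\<lambda>q. case (p, q) of (p, q) \<Rightarrow> snd q (snd p \<rho>)) has_sum G (snd p \<rho>)) Y" if "p \<in> X" for p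
      using Y(1) superop_on_pd[OF sX[OF that] \<rho>] by (simp add: represents_def)
    show "trace_pos (case (p, q) of (p, q) \<Rightarrow> snd q (snd p \<rho>))" if "p \<in> X" "q \<in> Y" for p q
      using pd_trace_pos[OF superop_on_pd[OF sY[OF that(2)] superop_on_pd[OF sX[OF that(1)] \<rho>]]]
      by simp
    show "trace_pos (G (snd p \<rho>))" if "p \<in> X" for p
      by (rule pd_trace_pos[OF superop_on_pd[OF sG superop_on_pd[OF sX[OF that] \<rho>]]])
    show "trace_pos (G (F \<rho>))"
      by (rule pd_trace_pos[OF superop_on_pd[OF sG superop_on_pd[OF sF \<rho>]]])
  qed
  then show ?thesis
    using superop_on_compose[OF sF sG] superop_on_compose[OF sX sY]
    by (intro represents_imageI[OF inj]) (auto simp: case_prod_unfold)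
qed

lemma represents_Cond:
  fixes X :: "'m \<Rightarrow> ('v, 'm) path set"
  assumes qs: "set qs \<subseteq> V" "measurement_on (set qs) ms M"
    and X: "\<And>m. m \<in> ms \<Longrightarrow> represents V (X m) (F m)" "\<And>m. m \<in> ms \<Longrightarrow> prefix_free (X m)"
  shows "represents V
    ((\<lambda>(m, p). (Outcome m # fst p, snd p \<circ> conj_superop V qs (M m))) ` (SIGMA m:ms. X m))
    (\<lambda>\<rho>. \<Sum>\<^sub>\<infinity>m\<in>ms. (F m \<circ> conj_superop V qs (M m)) \<rho>)"
proof -
  let ?K = "\<lambda>m. conj_superop V qs (M m)"
  let ?G = "\<lambda>\<rho>. \<Sum>\<^sub>\<infinity>m\<in>ms. F m (?K m \<rho>)"
  have inj: "inj_on (\<lambda>(m, p). (Outcome m # fst p, snd p \<circ> ?K m)) (SIGMA m:ms. X m)"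
  proof (rule inj_onI, clarsimp)
    fix m a K L
    assume "m \<in> ms" "(a, K) \<in> X m" "(a, L) \<in> X m"
    \<comment> \<open>Different effects could become equal after composition with the measurement.
      Equality before it holds because the label sequence determines the effect.\<close>
    then show "K = L"
      using prefix_freeD[OF X(2), of m "(a, K)" "(a, L)" "[]" "[]"] by simp
  qed
  note kraus = kraus_family_measurement[OF qs]
  have op: "op_on V (ext V (set qs) (M m))" if "m \<in> ms" for m
    using qs that by (simp add: measurement_on_def op_on_ext)
  have sK: "superop_on V (?K m)" if "m \<in> ms" for m
    unfolding conj_superop_def using superop_on_sandwich[OF kraus that op[OF that]] .
  have sF: "superop_on V (F m)" and sX: "\<And>p. p \<in> X m \<Longrightarrow> superop_on V (snd p)" if "m \<in> ms" for m
    using X(1)[OF that] by (auto simp: represents_def)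
  have sG: "superop_on V ?G" and G: "\<And>\<rho>. partial_density V \<rho> \<Longrightarrow> ((\<lambda>m. F m (?K m \<rho>)) has_sum ?G \<rho>) ms"
    using superop_on_kraus_sum[OF kraus op sF] by (simp_all add: conj_superop_def)
  have "((\<lambda>(m, p). snd p (?K m \<rho>)) has_sum ?G \<rho>) (SIGMA m:ms. X m)" if \<rho>: "partial_density V \<rho>" for \<rho>
  proof (rule trace_has_sum_SigmaI[OF _ _ _ _ G[OF \<rho>]])
    show "((\<lambda>p. case (m, p) of (m, p) \<Rightarrow> snd p (?K m \<rho>)) has_sum F m (?K m \<rho>)) (X m)" if "m \<in> ms" for m
      using X(1)[OF that] superop_on_pd[OF sK[OF that] \<rho>] by (simp add: represents_def)
    show "trace_pos (?G \<rho>)"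
      by (rule pd_trace_pos[OF superop_on_pd[OF sG \<rho>]])
    show "trace_pos (case (m, p) of (m, p) \<Rightarrow> snd p (?K m \<rho>))" if "m \<in> ms" "p \<in> X m" for m p
      using pd_trace_pos[OF superop_on_pd[OF sX[OF that] superop_on_pd[OF sK[OF that(1)] \<rho>]]]
      by simp
    show "trace_pos (F m (?K m \<rho>))" if "m \<in> ms" for m
      by (rule pd_trace_pos[OF superop_on_pd[OF sF[OF that] superop_on_pd[OF sK[OF that] \<rho>]]])
  qed
  then show ?thesis
    using sG superop_on_compose[OF sK sX]
    by (intro represents_imageI[OF inj]) (auto simp: case_prod_unfold)
qed

lemma represents_lub:
  fixes X :: "nat \<Rightarrow> ('v, 'm) path set"
  assumes "incseq X" and X: "\<And>k. represents V (X k) (E k)"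
  shows "represents V (\<Union>k. X k) (superop_lub V E)"
proof -
  let ?X = "\<Union>k. X k"
  let ?G = "\<lambda>\<rho>. \<Sum>\<^sub>\<infinity>p\<in>?X. snd p \<rho>"
  have sX: "superop_on V (snd p)" if "p \<in> ?X" for p
    using X that by (auto simp: represents_def)
  have sE: "superop_on V (E k)" and E: "\<And>\<rho>. partial_density V \<rho> \<Longrightarrow> ((\<lambda>p. snd p \<rho>) has_sum E k \<rho>) (X k)" for k
    using X by (auto simp: represents_def)
  \<comment> \<open>A finite partial sum over the union already occurs at one stage, so bounds valid
    for every \<open>E k\<close> carry over to the union.\<close>
  have finite_sub: "\<exists>k. N \<subseteq> X k" if "finite N" "N \<subseteq> ?X" for N
    using that
  proof induction
    case (insert p N)
    then obtain k l where "N \<subseteq> X k" "p \<in> X l" by auto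
    then have "insert p N \<subseteq> X (max k l)"
      using incseqD[OF assms(1), of k "max k l"] incseqD[OF assms(1), of l "max k l"] by auto
    then show ?case by blast
  qed auto
  have bound: "(\<Sum>p\<in>N. trace (snd p \<rho>)) \<le> trace \<rho>"
    if \<rho>: "partial_density V \<rho>" and N: "finite N" "N \<subseteq> ?X" for \<rho> N
  proof -
    obtain k where k: "N \<subseteq> X k"
      using finite_sub[OF N] by blast
    have tp: "trace_pos (snd p \<rho>)" if "p \<in> X k" for p
      using pd_trace_pos[OF superop_on_pd[OF sX \<rho>]] that by blast
    have "((\<lambda>p. trace (snd p \<rho>)) has_sum trace (E k \<rho>)) (X k)"
      by (rule has_sum_imp_trace_has_sum[OF tp E[OF \<rho>] pd_trace_pos[OF superop_on_pd[OF sE \<rho>]]])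
    then have "(\<Sum>p\<in>N. trace (snd p \<rho>)) \<le> trace (E k \<rho>)"
      by (rule finite_sum_le_has_sum[OF _ N(1) k]) (simp add: trace_nonneg[OF trace_posD[OF tp]])
    also have "\<dots> \<le> trace \<rho>"
      by (rule superop_on_trace[OF sE \<rho>])
    finally show ?thesis .
  qed
  have sG: "superop_on V ?G" and G: "\<And>\<rho>. partial_density V \<rho> \<Longrightarrow> ((\<lambda>p. snd p \<rho>) has_sum ?G \<rho>) ?X"
    using superop_on_family[of ?X V snd, OF sX bound] by blast+
  have lub: "superop_lub V E \<rho> = ?G \<rho>" if \<rho>: "partial_density V \<rho>" for \<rho>
    unfolding superop_lub_def
  proof (rule the_equality)
    have pos: "positive (snd p \<rho>)" if "p \<in> ?X" for p
      by (rule pd_positive[OF superop_on_pd[OF sX[OF that] \<rho>]])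
    have pd: "partial_density V (?G \<rho>)"
      by (rule superop_on_pd[OF sG \<rho>])
    \<comment> \<open>What \<open>E k\<close> lacks is the sum over the computations outside
      \<open>X k\<close>, a sum of positive operators.\<close>
    have upper: "lowner_le (E k \<rho>) (?G \<rho>)" for k
      unfolding lowner_le_def
      by (rule positive_has_sum[OF has_sum_Diff[OF G[OF \<rho>] E[OF \<rho>]]]) (use pos in auto)
    have least: "lowner_le (?G \<rho>) \<tau>" if \<tau>: "partial_density V \<tau>" "\<forall>k. lowner_le (E k \<rho>) \<tau>" for \<tau>
      unfolding lowner_le_def positive_iff
    proof (intro conjI allI)
      show "clinear_op (\<tau> - ?G \<rho>)"
        by (intro clinear_op_diff positive_clinear pd_positive[OF \<tau>(1)] pd_positive[OF pd])
      fix \<psi>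
      show "Im (cinner \<psi> (blinfun_apply (\<tau> - ?G \<rho>) \<psi>)) = 0"
        using pd_positive[OF \<tau>(1)] pd_positive[OF pd]
        by (simp add: blinfun.diff_left cinner_simps positive_iff)
      \<comment> \<open>Tested on a vector, the order is that of real numbers, and a sum of
        nonnegative reals is bounded as soon as its finite partial sums are.\<close>
      have "quad (?G \<rho>) \<psi> \<le> quad \<tau> \<psi>"
      proof (rule has_sum_le_finite_sums[OF quad_has_sum[OF G[OF \<rho>]]])
        fix N
        assume N: "finite N" "N \<subseteq> ?X"
        then obtain k where k: "N \<subseteq> X k"
          using finite_sub by blast
        have "(\<Sum>p\<in>N. quad (snd p \<rho>) \<psi>) \<le> quad (E k \<rho>) \<psi>"
          by (rule finite_sum_le_has_sum[OF quad_has_sum[OF E[OF \<rho>]] N(1) k])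
            (rule quad_nonneg, rule pos, blast)
        also have "\<dots> \<le> quad \<tau> \<psi>"
          using \<tau>(2) quad_nonneg[of "\<tau> - E k \<rho>" \<psi>]
          by (simp add: lowner_le_def blinfun.diff_left inner_diff_right)
        finally show "(\<Sum>p\<in>N. quad (snd p \<rho>) \<psi>) \<le> quad \<tau> \<psi>" .
      qed
      then show "0 \<le> quad (\<tau> - ?G \<rho>) \<psi>"
        by (simp add: blinfun.diff_left inner_diff_right)
    qed
    show *: "partial_density V (?G \<rho>) \<and> (\<forall>k. lowner_le (E k \<rho>) (?G \<rho>)) \<and>
        (\<forall>\<tau>. partial_density V \<tau> \<and> (\<forall>k. lowner_le (E k \<rho>) \<tau>) \<longrightarrow> lowner_le (?G \<rho>) \<tau>)"
      using pd upper least by blast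
    fix \<sigma>
    assume \<sigma>: "partial_density V \<sigma> \<and> (\<forall>k. lowner_le (E k \<rho>) \<sigma>) \<and>
        (\<forall>\<tau>. partial_density V \<tau> \<and> (\<forall>k. lowner_le (E k \<rho>) \<tau>) \<longrightarrow> lowner_le \<sigma> \<tau>)"
    have "positive (\<sigma> - ?G \<rho>)" "positive (- (\<sigma> - ?G \<rho>))"
      using \<sigma> * by (auto simp: lowner_le_def)
    then show "\<sigma> = ?G \<rho>"
      using positive_antisym by fastforce
  qed
  have "superop_on V (superop_lub V E)"
    by (rule superop_on_cong[OF sG]) (simp add: lub)
  then show ?thesis
    using sX G lub by (simp add: represents_def)
qed

lemma vars_of_subset:
  "vars_of D S \<subseteq> vars_of D (Seq S T)"
  "vars_of D T \<subseteq> vars_of D (Seq S T)"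
  "m \<in> ms \<Longrightarrow> vars_of D (P m) \<subseteq> vars_of D (Cond qs ms M P)"
  "set qs \<subseteq> vars_of D (Cond qs ms M P)"
  "set qs \<subseteq> vars_of D (Unitary qs U)"
  "q \<in> vars_of D (Init q)"
  "i < length D \<Longrightarrow> vars_of D (D ! i) \<subseteq> vars_of D (Call i)"
  by (auto simp: vars_of_def intro: qvars.intros)

lemma sandwich_id: "sandwich id_blinfun id_blinfun = (\<lambda>\<rho>. \<rho>)"
  by (auto simp: sandwich_def fun_eq_iff intro: blinfun_eqI)

lemma sandwich_0: "sandwich 0 0 = (\<lambda>_. 0)"
  by (auto simp: sandwich_def fun_eq_iff intro: blinfun_eqI)

text \<open>The assumption on \<open>\<eta>\<close> concerns the procedures whose variables lie in
  \<open>V\<close>. Every called procedure is among them, since \<open>vars_of\<close> includes the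
  variables of called bodies; procedures that are never reached may use other variables.\<close>

lemma represents_den:
  assumes X: "\<And>i. prefix_free (X i)"
    and \<eta>: "\<And>i. i < length D \<Longrightarrow> vars_of D (D ! i) \<subseteq> V \<Longrightarrow> represents V (X i) (\<eta> i)"
  shows "wf_stmt (length D) S \<Longrightarrow> vars_of D S \<subseteq> V \<Longrightarrow> represents V (paths V X S) (den V \<eta> S)"
proof (induction S)
  case Bottom
  then show ?case by (simp add: sandwich_0 represents_singleton superop_on_0)
next
  case Skip
  then show ?case by (simp add: sandwich_id represents_singleton superop_on_id)
next
  case (Init q)
  then show ?case
    using vars_of_subset(6)[of q D] by (auto intro!: represents_singleton superop_on_init)
next
  case (Unitary qs U)
  then show ?case
    using vars_of_subset(5)[of qs D U] by (auto intro!: represents_singleton superop_on_unitary)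
next
  case (Seq S T)
  have "vars_of D S \<subseteq> V" "vars_of D T \<subseteq> V"
    using Seq.prems vars_of_subset(1,2) by blast+
  then have "represents V (paths V X S) (den V \<eta> S)" "represents V (paths V X T) (den V \<eta> T)"
    using Seq by auto
  then show ?case
    unfolding paths.simps den.simps by (intro represents_Seq prefix_free_paths X)
next
  case (Cond qs ms M P)
  have "represents V (paths V X (P m)) (den V \<eta> (P m))" if "m \<in> ms" for m
    using Cond.IH[of "P m"] Cond.prems vars_of_subset(3)[OF that, of D P qs M] that by auto
  moreover have "set qs \<subseteq> V" "measurement_on (set qs) ms M"
    using Cond.prems vars_of_subset(4)[of qs D ms M P] by auto
  ultimately show ?case
    unfolding paths.simps den.simps by (intro represents_Cond prefix_free_paths X)
next
  case (Call i)
  then show ?case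
    using vars_of_subset(7)[of i D] \<eta> by auto
qed

text \<open>Replacing calls by statements amounts to changing the meaning of calls. An approximant
  is thereby the original body read with the previous approximants as meanings, so that
  \<open>represents_den\<close> applies to the body itself.\<close>

lemma den_subst_calls: "den V \<eta> (subst_calls f S) = den V (\<lambda>j. den V \<eta> (f j)) S"
  by (induction S) auto

lemma den_approx_Suc:
  "den V \<eta> (approx D (Suc k) i) = den V (\<lambda>j. den V \<eta> (approx D k j)) (D ! i)"
  by (simp add: den_subst_calls sandwich_id o_def)

text \<open>Induction on the depth, with the approximants of depth \<open>k\<close> as meanings of
  the calls in the body. At depth 0 an empty sum meets the zero map, and the added
  \<open>Eps\<close> changes labels but no effect.\<close>

lemma represents_approx:
  assumes wf: "\<forall>i<length D. wf_stmt (length D) (D ! i)"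
  shows "i < length D \<Longrightarrow> vars_of D (D ! i) \<subseteq> V \<Longrightarrow>
    represents V (call_paths V D k i) (den V (\<lambda>_ _. 0) (approx D k i))"
proof (induction k arbitrary: i)
  case 0
  then show ?case
    by (simp add: represents_def sandwich_0 superop_on_0)
next
  case (Suc k)
  have "represents V (paths V (call_paths V D k) (D ! i)) (den V (\<lambda>_ _. 0) (approx D (Suc k) i))"
    unfolding den_approx_Suc
    by (rule represents_den[OF prefix_free_call_paths Suc.IH]) (use wf Suc.prems in auto)
  then show ?case
    using represents_relabel[of V _ _ "Cons Eps"] Suc.prems by simp
qed

section \<open>Computations and transitions\<close>

lemma steps_Cons:
  assumes "proper_step V D S \<rho> l S' \<rho>'" "steps V D S' \<rho>' \<beta> C"
  shows "steps V D S \<rho> (l # \<beta>) C"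
  using steps.intros(2)[OF steps.intros(1)[OF step.intros(1)[OF assms(1)]] assms(2)] by simp

lemma steps_single: "proper_step V D S \<rho> l S' \<rho>' \<Longrightarrow> steps V D S \<rho> [l] (Conf S' \<rho>')"
  by (intro steps.intros step.intros)

lemma step_Conf_iff: "step V D S \<rho> l (Conf S' \<rho>') \<longleftrightarrow> proper_step V D S \<rho> l S' \<rho>'"
  by (auto elim: step.cases intro: step.intros)

lemma not_proper_step_None: "\<not> proper_step V D None \<rho> l S' \<rho>'"
  by (auto elim: proper_step.cases)

text \<open>The empty statement steps only to \<open>Fail\<close>, and multi-step transitions
  continue only from a \<open>Conf\<close>.\<close>

lemma not_steps_None: "\<not> steps V D None \<rho> \<alpha> (Conf S' \<rho>')"
  using steps_first[of V D None \<rho> \<alpha> "Conf S' \<rho>'"] by (auto simp: step_Conf_iff not_proper_step_None)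

lemma steps_Conf_cases:
  assumes "steps V D (Some S) \<rho> \<alpha> (Conf None \<rho>')"
  obtains l where "\<alpha> = [l]" "proper_step V D (Some S) \<rho> l None \<rho>'"
  | l \<beta> S' \<sigma> where "\<alpha> = l # \<beta>" "proper_step V D (Some S) \<rho> l (Some S') \<sigma>"
      "steps V D (Some S') \<sigma> \<beta> (Conf None \<rho>')"
  using steps_first[OF assms] by (metis not_steps_None option.exhaust step_Conf_iff)

lemma steps_Seq:
  "steps V D (Some S) \<rho> \<alpha> (Conf None \<rho>') \<Longrightarrow> steps V D (Some (Seq S T)) \<rho> \<alpha> (Conf (Some T) \<rho>')"
proof (induction \<alpha> arbitrary: S \<rho>)
  case Nil
  then show ?case using steps_nonempty by blast
next
  case (Cons l \<beta>)
  from Cons.prems show ?case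
    by (cases rule: steps_Conf_cases)
      (auto intro: steps_single steps_Cons proper_step.intros Cons.IH)
qed

text \<open>Stated for arbitrary \<open>X\<close> so that it serves both the induction on call depth
  and the union over all depths.\<close>

lemma paths_imp_steps_aux:
  assumes "\<And>i p \<rho>. p \<in> X i \<Longrightarrow> steps V D (Some (Call i)) \<rho> (fst p) (Conf None (snd p \<rho>))"
  shows "p \<in> paths V X S \<Longrightarrow> steps V D (Some S) \<rho> (fst p) (Conf None (snd p \<rho>))"
proof (induction S arbitrary: p \<rho>)
  case (Seq S T)
  then obtain a F b G where p: "p = (a @ b, G \<circ> F)" "(a, F) \<in> paths V X S" "(b, G) \<in> paths V X T"
    by force
  show ?case
    using steps.intros(2)[OF steps_Seq[OF Seq.IH(1)[OF p(2)]] Seq.IH(2)[OF p(3)]] by (simp add: p(1))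
next
  case (Cond qs ms M P)
  then obtain m a F where p: "p = (Outcome m # a, F \<circ> conj_superop V qs (M m))" "m \<in> ms"
    "(a, F) \<in> paths V X (P m)"
    by force
  show ?case
    using steps_Cons[OF proper_step.intros(7)[OF p(2), where P = P and M = M and qs = qs]
        Cond.IH[OF rangeI p(3)]]
    by (simp add: p(1))
qed (auto intro: steps_single proper_step.intros assms)

lemma paths_imp_steps:
  assumes "p \<in> paths V (\<lambda>i. \<Union>k. call_paths V D k i) S"
  shows "steps V D (Some S) \<rho> (fst p) (Conf None (snd p \<rho>))"
proof -
  have call: "p \<in> call_paths V D k i \<Longrightarrow> steps V D (Some (Call i)) \<rho> (fst p) (Conf None (snd p \<rho>))"
    for k i p \<rho>
  proof (induction k arbitrary: i p \<rho>)
    case (Suc k)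
    then obtain a F where p: "p = (Eps # a, F)" "i < length D" "(a, F) \<in> paths V (call_paths V D k) (D ! i)"
      by (auto split: if_splits)
    show ?case
      using steps_Cons[OF proper_step.intros(8)[OF p(2)] paths_imp_steps_aux[OF Suc.IH p(3)]]
      by (simp add: p(1))
  qed simp
  show ?thesis
    by (rule paths_imp_steps_aux[OF _ assms]) (auto intro: call)
qed

text \<open>One transition is prepended to the computations of its successor. The effect
  \<open>F\<close> is compared at \<open>\<rho>\<close> alone, because a transition mentions no
  other state; \<open>None\<close> is treated apart, as \<open>paths\<close> has no clause for the
  empty statement.\<close>

lemma proper_step_paths:
  fixes S :: "('a, 'b) stmt"
  assumes X: "X = (\<lambda>i. \<Union>k. call_paths V D k i)" and "proper_step V D C \<rho> l C' \<rho>'" "C = Some S"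
  shows "case C' of None \<Rightarrow> \<exists>F. ([l], F) \<in> paths V X S \<and> F \<rho> = \<rho>'
    | Some S' \<Rightarrow> \<forall>p\<in>paths V X S'. \<exists>F. (l # fst p, F) \<in> paths V X S \<and> F \<rho> = snd p \<rho>'"
  using assms(2,3)
proof (induction arbitrary: S rule: proper_step.induct)
  case (5 S1 \<rho> l S1' \<rho>' T)
  have IH: "\<forall>p\<in>paths V X S1'. \<exists>F. (l # fst p, F) \<in> paths V X S1 \<and> F \<rho> = snd p \<rho>'"
    using "5.IH" by simp
  have "\<exists>F. (l # fst p, F) \<in> paths V X (Seq S1 T) \<and> F \<rho> = snd p \<rho>'" if p: "p \<in> paths V X (Seq S1' T)" for p
  proof -
    obtain r q where rq: "p = (fst r @ fst q, snd q \<circ> snd r)" "r \<in> paths V X S1'" "q \<in> paths V X T"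
      using p by force
    then obtain F where F: "(l # fst r, F) \<in> paths V X S1" "F \<rho> = snd r \<rho>'"
      using IH by blast
    have "(l # fst p, snd q \<circ> F) \<in> paths V X (Seq S1 T)"
      using rq F(1) by (force simp: image_iff)
    then show ?thesis using F(2) rq(1) by fastforce
  qed
  moreover have "S = Seq S1 T"
    using "5.prems" by simp
  ultimately show ?case
    unfolding option.case by blast
next
  case (6 S1 \<rho> l \<rho>' T)
  obtain F where F: "([l], F) \<in> paths V X S1" "F \<rho> = \<rho>'"
    using "6.IH" by auto
  have "(l # fst q, snd q \<circ> F) \<in> paths V X (Seq S1 T)" if "q \<in> paths V X T" for q
    using that F(1) by (force simp: image_iff)
  moreover have "S = Seq S1 T"
    using "6.prems" by simp
  moreover have "(snd q \<circ> F) \<rho> = snd q \<rho>'" for q :: "('a, 'b) path"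
    using F(2) by simp
  ultimately show ?case
    unfolding option.case by blast
next
  case (7 m ms qs M P \<rho>)
  then show ?case by (fastforce simp: image_iff)
next
  case (8 i \<rho>)
  have "(Eps # fst p, snd p) \<in> X i" if p: "p \<in> paths V X (D ! i)" for p
  proof -
    \<comment> \<open>A path of the body over the limit already occurs for some depth
      \<open>k\<close> of its calls; the unfolding step puts it at depth
      \<open>k + 1\<close>.\<close>
    obtain k where "p \<in> paths V (call_paths V D k) (D ! i)"
      using p paths_UN_subset[of "call_paths V D" V "D ! i"] incseq_call_paths unfolding X by blast
    then have "(Eps # fst p, snd p) \<in> call_paths V D (Suc k) i"
      using 8 by auto
    then show ?thesis unfolding X by blast
  qed
  note call = this
  have S: "S = Call i"
    using 8 by simp
  show ?case
    unfolding S option.case paths.simps using call by blast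
qed auto

lemma steps_imp_paths:
  assumes X: "X = (\<lambda>i. \<Union>k. call_paths V D k i)"
  shows "steps V D (Some S) \<rho> \<alpha> (Conf None \<rho>') \<Longrightarrow> \<exists>F. (\<alpha>, F) \<in> paths V X S \<and> F \<rho> = \<rho>'"
proof (induction \<alpha> arbitrary: S \<rho>)
  case Nil
  then show ?case using steps_nonempty by blast
next
  case (Cons l \<beta>)
  from Cons.prems show ?case
  proof (cases rule: steps_Conf_cases)
    case 1
    then show ?thesis using proper_step_paths[OF X] by fastforce
  next
    case (2 l' \<beta>' S' \<sigma>)
    obtain G where "(\<beta>', G) \<in> paths V X S'" "G \<sigma> = \<rho>'"
      using Cons.IH[of S' \<sigma>] 2 by auto
    then show ?thesis using 2 proper_step_paths[OF X 2(2) refl] by fastforce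
  qed
qed

theorem theorem3p11:
  fixes D :: "('v, 'm) stmt list" and S :: "('v, 'm) stmt"
    and V :: "'v qvar set" and \<rho> :: "'v qop"
  assumes "\<forall>i<length D. wf_stmt (length D) (D ! i)"
    and "wf_stmt (length D) S"
    and "finite V" and "vars_of D S \<subseteq> V"
    and "partial_density V \<rho>"
  shows "((\<lambda>\<alpha>. THE \<rho>'. steps V D (Some S) \<rho> \<alpha> (Conf None \<rho>'))
           has_sum denot V D S \<rho>)
         {\<alpha>. \<exists>\<rho>'. steps V D (Some S) \<rho> \<alpha> (Conf None \<rho>')}"
proof -
  define X where "X = (\<lambda>i. \<Union>k. call_paths V D k i)"
  have free: "prefix_free (X i)" for i
    unfolding X_def by (rule prefix_free_UN[OF incseq_call_paths prefix_free_call_paths])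
  have "represents V (X i) (superop_lub V (\<lambda>k. den V (\<lambda>_ _. 0) (approx D k i)))"
    if "i < length D" "vars_of D (D ! i) \<subseteq> V" for i
    unfolding X_def
    by (rule represents_lub[OF incseq_call_paths represents_approx[OF assms(1) that]])
  then have "represents V (paths V X S) (denot V D S)"
    unfolding denot_def by (rule represents_den[OF free _ assms(2,4)])
  then have "((\<lambda>p. snd p \<rho>) has_sum denot V D S \<rho>) (paths V X S)"
    using assms(5) by (simp add: represents_def)
  \<comment> \<open>A label sequence determines the configuration reached, so the description
    selects the effect of the computation on \<open>\<rho>\<close>.\<close>
  moreover have the_eq: "(THE \<rho>'. steps V D (Some S) \<rho> (fst p) (Conf None \<rho>')) = snd p \<rho>"
    if "p \<in> paths V X S" for p
  proof (rule the_equality)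
    show *: "steps V D (Some S) \<rho> (fst p) (Conf None (snd p \<rho>))"
      using paths_imp_steps that unfolding X_def .
    show "\<rho>' = snd p \<rho>" if "steps V D (Some S) \<rho> (fst p) (Conf None \<rho>')" for \<rho>'
      using steps_deterministic[OF * that] by simp
  qed
  ultimately have "(((\<lambda>\<alpha>. THE \<rho>'. steps V D (Some S) \<rho> \<alpha> (Conf None \<rho>')) \<circ> fst)
      has_sum denot V D S \<rho>) (paths V X S)"
    by (subst has_sum_cong[where g = "\<lambda>p. snd p \<rho>"]) (simp_all add: the_eq)
  \<comment> \<open>Computations with equal label sequences coincide, so the sum may be reindexed by
    label sequences, while equal final states remain separate terms.\<close>
  moreover have "inj_on fst (paths V X S)"
    by (rule inj_onI, rule prefix_freeD[OF prefix_free_paths[OF free], where \<gamma> = "[]" and \<delta> = "[]"])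
      auto
  moreover have "{\<alpha>. \<exists>\<rho>'. steps V D (Some S) \<rho> \<alpha> (Conf None \<rho>')} = fst ` paths V X S"
  proof (intro equalityI subsetI)
    fix \<alpha>
    assume "\<alpha> \<in> {\<alpha>. \<exists>\<rho>'. steps V D (Some S) \<rho> \<alpha> (Conf None \<rho>')}"
    then obtain F where "(\<alpha>, F) \<in> paths V X S"
      using steps_imp_paths[OF X_def] by blast
    then show "\<alpha> \<in> fst ` paths V X S"
      by force
  next
    fix \<alpha>
    assume "\<alpha> \<in> fst ` paths V X S"
    then show "\<alpha> \<in> {\<alpha>. \<exists>\<rho>'. steps V D (Some S) \<rho> \<alpha> (Conf None \<rho>')}"
      using paths_imp_steps unfolding X_def by blast
  qed
  ultimately show ?thesis
    by (simp add: has_sum_reindex)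
qed

end
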